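(* Let $V_2^+$ (resp. $V_2^-$) be the space of co-closed $(1,0)$-forms (resp. co-closed $(0,1)$-forms) in $L^2\Lambda^1(H_n)$. If $\omega\in V_2^{\pm}$, then $$\Delta_1\omega=(\Delta_0\mp iT)\omega$$ in the sense of distributions, where $\Delta_0\mp iT$ acts componentwise.
   Context: $n\ge1$; $H_n=\mathbb R^n\times\mathbb R^n\times\mathbb R$ is the Heisenberg group with coordinates $(x,y,t)$, Lebesgue (Haar) measure, and left-invariant vector fields $X_j=\partial_{x_j}-\frac{y_j}{2}\partial_t$, $Y_j=\partial_{y_j}+\frac{x_j}{2}\partial_t$, $T=\partial_t$ ($1\le j\le n$), dual to the $1$-forms $dx_j$, $dy_j$, $\theta=dt-\frac12\sum_j(x_jdy_j-y_jdx_j)$. Put $B_j=\frac1{\sqrt2}(X_j-iY_j)$, $\bar B_j=\frac1{\sqrt2}(X_j+iY_j)$, $\beta_j=\frac1{\sqrt2}(dx_j+idy_j)$, $\bar\beta_j=\frac1{\sqrt2}(dx_j-idy_j)$. Then $df=\sum_j(B_jf\,\beta_j+\bar B_jf\,\bar\beta_j)+Tf\,\theta$. $L^2\Lambda^1(H_n)$ is the space of $1$-forms $\omega=\sum_jf_j\beta_j+\sum_jg_j\bar\beta_j+h\theta$ with $f_j,g_j,h\in L^2(H_n)$, the frame $\beta_j,\bar\beta_j,\theta$ being pointwise orthonormal. A $(1,0)$-form is $\sum_jf_j\beta_j$, a $(0,1)$-form is $\sum_jg_j\bar\beta_j$. $d^*$ is the formal adjoint of $d$ ($d^*\omega=-\sum_j\bar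 B_jf_j-\sum_jB_jg_j-Th$ on $1$-forms), and $\omega$ is co-closed if $d^*\omega=0$ in the sense of distributions. $\Delta_0=d^*d=-\sum_j(X_j^2+Y_j^2)-T^2$ on functions, $\Delta_1=dd^*+d^*d$ on $1$-forms. A scalar operator acting componentwise acts on each coefficient with respect to the frame $\beta_j,\bar\beta_j,\theta$. *)

theory Defs
  imports "HOL-Analysis.Analysis"
begin

section \<open>The Heisenberg group in coordinates\<close>

text \<open>
  The Heisenberg group \<open>H_n\<close> is represented by its coordinates \<open>(x, y, t)\<close>, with
  \<open>n = CARD('n)\<close>. Tangent vectors at a point are identified with elements of the same
  vector space. The Haar measure is Lebesgue measure.
\<close>

type_synonym 'n heis = "(real^'n) \<times> (real^'n) \<times> real"

type_synonym 'n vfield = "'n heis \<Rightarrow> 'n heis"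

definition X_field :: "'n::finite \<Rightarrow> 'n vfield" where
  "X_field j = (\<lambda>(x, y, t). (axis j 1, 0, - (y $ j) / 2))"

definition Y_field :: "'n::finite \<Rightarrow> 'n vfield" where
  "Y_field j = (\<lambda>(x, y, t). (0, axis j 1, x $ j / 2))"

definition T_field :: "('n::finite) vfield" where
  "T_field = (\<lambda>p. (0, 0, 1))"

definition vf_apply :: "('n::finite) vfield \<Rightarrow> ('n heis \<Rightarrow> complex) \<Rightarrow> 'n heis \<Rightarrow> complex" where
  "vf_apply V f = (\<lambda>p. frechet_derivative f (at p) (V p))"


section \<open>Differential forms and the unitary frame\<close>

text \<open>
  Complex-valued forms are functions of the base point and of real tangent vectors, real-linear
  (and, for 2-forms, alternating) in the latter.
\<close>

type_synonym 'n form1 = "'n heis \<Rightarrow> 'n heis \<Rightarrow> complex"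
type_synonym 'n form2 = "'n heis \<Rightarrow> 'n heis \<Rightarrow> 'n heis \<Rightarrow> complex"

definition dx :: "'n::finite \<Rightarrow> 'n form1" where
  "dx j p v = complex_of_real (fst v $ j)"

definition dy :: "'n::finite \<Rightarrow> 'n form1" where
  "dy j p v = complex_of_real (fst (snd v) $ j)"

definition dt :: "('n::finite) form1" where
  "dt p v = complex_of_real (snd (snd v))"

definition theta :: "('n::finite) form1" where
  "theta p v = dt p v -
     (\<Sum>j\<in>UNIV. complex_of_real (fst p $ j) * dy j p v
              - complex_of_real (fst (snd p) $ j) * dx j p v) / 2"

datatype 'n frame_index = Beta 'n | BetaBar 'n | Theta

lemma UNIV_frame_index: "UNIV = range Beta \<union> range BetaBar \<union> {Theta}"
proof -
  have "a \<in> range Beta \<union> range BetaBar \<union> {Theta}" for a :: "'n frame_index"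
    by (cases a) auto
  then show ?thesis by blast
qed

instance frame_index :: (finite) finite
  by standard (simp add: UNIV_frame_index)

fun coframe :: "('n::finite) frame_index \<Rightarrow> 'n form1" where
  "coframe (Beta j) = (\<lambda>p v. (dx j p v + \<i> * dy j p v) / complex_of_real (sqrt 2))"
| "coframe (BetaBar j) = (\<lambda>p v. (dx j p v - \<i> * dy j p v) / complex_of_real (sqrt 2))"
| "coframe Theta = theta"

text \<open>
  The dual frame \<open>B\<^sub>j = (X\<^sub>j - \<i> Y\<^sub>j) / \<surd>2\<close>, \<open>(X\<^sub>j + \<i> Y\<^sub>j) / \<surd>2\<close>, \<open>T\<close>. A complex tangent vector
  \<open>U + \<i> V\<close> is encoded as the pair \<open>(U, V)\<close>, and forms are evaluated on such vectors by
  complex-linear extension.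
\<close>

fun frame :: "('n::finite) frame_index \<Rightarrow> 'n heis \<Rightarrow> 'n heis \<times> 'n heis" where
  "frame (Beta j) p = ((1 / sqrt 2) *\<^sub>R X_field j p, - ((1 / sqrt 2) *\<^sub>R Y_field j p))"
| "frame (BetaBar j) p = ((1 / sqrt 2) *\<^sub>R X_field j p, (1 / sqrt 2) *\<^sub>R Y_field j p)"
| "frame Theta p = (T_field p, 0)"

definition ceval :: "('v \<Rightarrow> complex) \<Rightarrow> 'v \<times> 'v \<Rightarrow> complex" where
  "ceval \<alpha> Z = \<alpha> (fst Z) + \<i> * \<alpha> (snd Z)"

definition coeff1 :: "('n::finite) form1 \<Rightarrow> 'n frame_index \<Rightarrow> 'n heis \<Rightarrow> complex" where
  "coeff1 \<omega> a p = ceval (\<omega> p) (frame a p)"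

definition coeff2 ::
  "('n::finite) form2 \<Rightarrow> 'n frame_index \<Rightarrow> 'n frame_index \<Rightarrow> 'n heis \<Rightarrow> complex" where
  "coeff2 \<psi> a b p = ceval (\<lambda>v. ceval (\<psi> p v) (frame b p)) (frame a p)"

definition form_of :: "('n::finite frame_index \<Rightarrow> 'n heis \<Rightarrow> complex) \<Rightarrow> 'n form1" where
  "form_of c = (\<lambda>p v. \<Sum>a\<in>UNIV. c a p * coframe a p v)"


section \<open>Test functions, test forms and exterior derivative\<close>

fun continuously_differentiable ::
  "nat \<Rightarrow> ('a::real_normed_vector \<Rightarrow> 'b::real_normed_vector) \<Rightarrow> bool" where
  "continuously_differentiable 0 f \<longleftrightarrow> continuous_on UNIV f"
| "continuously_differentiable (Suc k) f \<longleftrightarrow>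
     (\<forall>x. f differentiable at x) \<and>
     (\<forall>v. continuously_differentiable k (\<lambda>x. frechet_derivative f (at x) v))"

definition smooth :: "('a::real_normed_vector \<Rightarrow> 'b::real_normed_vector) \<Rightarrow> bool" where
  "smooth f \<longleftrightarrow> (\<forall>k. continuously_differentiable k f)"

definition test_functions :: "(('n::finite) heis \<Rightarrow> complex) set" where
  "test_functions = {f. smooth f \<and> compact (closure {p. f p \<noteq> 0})}"

definition test_forms1 :: "('n::finite) form1 set" where
  "test_forms1 = {form_of c |c. \<forall>a. c a \<in> test_functions}"

definition ext_d0 :: "(('n::finite) heis \<Rightarrow> complex) \<Rightarrow> 'n form1" where
  "ext_d0 f = (\<lambda>p v. frechet_derivative f (at p) v)"

definition ext_d1 :: "('n::finite) form1 \<Rightarrow> 'n form2" where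
  "ext_d1 \<omega> = (\<lambda>p v w. frechet_derivative (\<lambda>q. \<omega> q w) (at p) v
                      - frechet_derivative (\<lambda>q. \<omega> q v) (at p) w)"


section \<open>Hermitian \<open>L\<^sup>2\<close> pairings and the formal adjoint\<close>

text \<open>
  The frame \<open>\<beta>\<^sub>j\<close>, its conjugate and \<open>\<theta>\<close> are orthonormal, and so are the products of two distinct
  frame elements in degree 2; summing over ordered pairs counts each of them twice.
\<close>

definition pair0 :: "(('n::finite) heis \<Rightarrow> complex) \<Rightarrow> ('n heis \<Rightarrow> complex) \<Rightarrow> complex" where
  "pair0 f g = integral\<^sup>L lebesgue (\<lambda>p. f p * cnj (g p))"

definition pair1 :: "('n::finite) form1 \<Rightarrow> 'n form1 \<Rightarrow> complex" where
  "pair1 \<omega> \<phi> = integral\<^sup>L lebesgue (\<lambda>p. \<Sum>a\<in>UNIV. coeff1 \<omega> a p * cnj (coeff1 \<phi> a p))"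

definition pair2 :: "('n::finite) form2 \<Rightarrow> 'n form2 \<Rightarrow> complex" where
  "pair2 \<psi> \<eta> = integral\<^sup>L lebesgue
     (\<lambda>p. (\<Sum>a\<in>UNIV. \<Sum>b\<in>UNIV. coeff2 \<psi> a b p * cnj (coeff2 \<eta> a b p)) / 2)"

text \<open>
  \<open>formal_adjoint A \<langle>_,_\<rangle>\<^sub>A \<langle>_,_\<rangle>\<^sub>B D \<psi>\<close> is the unique \<open>\<alpha> \<in> A\<close> with
  \<open>\<langle>\<alpha>, \<phi>\<rangle>\<^sub>A = \<langle>\<psi>, D \<phi>\<rangle>\<^sub>B\<close> for all \<open>\<phi> \<in> A\<close>. For the exterior derivative and compactly supported
  smooth \<open>\<psi>\<close> it exists by integration by parts.
\<close>

definition formal_adjoint ::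
  "'a set \<Rightarrow> ('a \<Rightarrow> 'a \<Rightarrow> complex) \<Rightarrow> ('b \<Rightarrow> 'b \<Rightarrow> complex) \<Rightarrow> ('a \<Rightarrow> 'b) \<Rightarrow> 'b \<Rightarrow> 'a" where
  "formal_adjoint A ipA ipB D \<psi> = (THE \<alpha>. \<alpha> \<in> A \<and> (\<forall>\<phi>\<in>A. ipA \<alpha> \<phi> = ipB \<psi> (D \<phi>)))"

definition codiff1 :: "('n::finite) form1 \<Rightarrow> 'n heis \<Rightarrow> complex" where
  "codiff1 = formal_adjoint test_functions pair0 pair1 ext_d0"

definition codiff2 :: "('n::finite) form2 \<Rightarrow> 'n form1" where
  "codiff2 = formal_adjoint test_forms1 pair1 pair2 ext_d1"


section \<open>Distributions\<close>

text \<open>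
  A distribution of degree 0, 1 or 2 is a functional on test functions, test 1-forms or test
  2-forms; only its values on those are meaningful. Functionals are conjugate-linear: a locally
  integrable \<open>\<omega>\<close> gives \<open>\<phi> \<mapsto> \<langle>\<omega>, \<phi>\<rangle>\<close>. Hence \<open>d\<close> and its formal adjoint act on distributions as
  precomposition with each other, and a real divergence-free vector field \<open>V\<close> (in particular each
  of \<open>X\<^sub>j\<close>, \<open>Y\<^sub>j\<close>, \<open>T\<close>) acts by \<open>(V u)(\<phi>) = - u(V \<phi>)\<close>.
\<close>

type_synonym 'n dist0 = "('n heis \<Rightarrow> complex) \<Rightarrow> complex"
type_synonym 'n dist1 = "'n form1 \<Rightarrow> complex"
type_synonym 'n dist2 = "'n form2 \<Rightarrow> complex"

definition dist_of_form1 :: "('n::finite) form1 \<Rightarrow> 'n dist1" where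
  "dist_of_form1 \<omega> = (\<lambda>\<phi>. pair1 \<omega> \<phi>)"

definition dist_ext_d0 :: "('n::finite) dist0 \<Rightarrow> 'n dist1" where
  "dist_ext_d0 u = (\<lambda>\<phi>. u (codiff1 \<phi>))"

definition dist_ext_d1 :: "('n::finite) dist1 \<Rightarrow> 'n dist2" where
  "dist_ext_d1 u = (\<lambda>\<psi>. u (codiff2 \<psi>))"

definition dist_codiff1 :: "('n::finite) dist1 \<Rightarrow> 'n dist0" where
  "dist_codiff1 u = (\<lambda>f. u (ext_d0 f))"

definition dist_codiff2 :: "('n::finite) dist2 \<Rightarrow> 'n dist1" where
  "dist_codiff2 u = (\<lambda>\<phi>. u (ext_d1 \<phi>))"

definition dist_Laplace1 :: "('n::finite) dist1 \<Rightarrow> 'n dist1" where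
  "dist_Laplace1 u =
     (\<lambda>\<phi>. dist_ext_d0 (dist_codiff1 u) \<phi> + dist_codiff2 (dist_ext_d1 u) \<phi>)"

definition dist_vf :: "('n::finite) vfield \<Rightarrow> 'n dist0 \<Rightarrow> 'n dist0" where
  "dist_vf V u = (\<lambda>f. - u (vf_apply V f))"

definition dist_Laplace0 :: "('n::finite) dist0 \<Rightarrow> 'n dist0" where
  "dist_Laplace0 u = (\<lambda>f.
     - (\<Sum>j\<in>UNIV. dist_vf (X_field j) (dist_vf (X_field j) u) f
                + dist_vf (Y_field j) (dist_vf (Y_field j) u) f)
     - dist_vf T_field (dist_vf T_field u) f)"

text \<open>
  The coefficient of a degree 1 distribution \<open>u\<close> along a member \<open>e\<^sub>a\<close> of the orthonormal coframe is
  \<open>u\<^sub>a(f) = u(f e\<^sub>a)\<close>, and \<open>u(\<phi>) = \<Sum>\<^sub>a u\<^sub>a(\<phi>\<^sub>a)\<close>.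
\<close>

definition dist_coeff :: "('n::finite) dist1 \<Rightarrow> 'n frame_index \<Rightarrow> 'n dist0" where
  "dist_coeff u a = (\<lambda>f. u (\<lambda>p v. f p * coframe a p v))"

definition componentwise :: "(('n::finite) dist0 \<Rightarrow> 'n dist0) \<Rightarrow> 'n dist1 \<Rightarrow> 'n dist1" where
  "componentwise P u = (\<lambda>\<phi>. \<Sum>a\<in>UNIV. P (dist_coeff u a) (coeff1 \<phi> a))"

definition dist1_eq :: "('n::finite) dist1 \<Rightarrow> 'n dist1 \<Rightarrow> bool" where
  "dist1_eq u v \<longleftrightarrow> (\<forall>\<phi>\<in>test_forms1. u \<phi> = v \<phi>)"


section \<open>Square-integrable co-closed forms of pure type\<close>

definition L2_functions :: "(('n::finite) heis \<Rightarrow> complex) set" where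
  "L2_functions =
     {f. f \<in> borel_measurable lebesgue \<and> integrable lebesgue (\<lambda>p. (cmod (f p))\<^sup>2)}"

definition L2_forms1 :: "('n::finite) form1 set" where
  "L2_forms1 = {form_of c |c. \<forall>a. c a \<in> L2_functions}"

definition forms_1_0 :: "('n::finite) form1 set" where
  "forms_1_0 = {\<omega>. \<exists>f. \<omega> = (\<lambda>p v. \<Sum>j\<in>UNIV. f j p * coframe (Beta j) p v)}"

definition forms_0_1 :: "('n::finite) form1 set" where
  "forms_0_1 = {\<omega>. \<exists>g. \<omega> = (\<lambda>p v. \<Sum>j\<in>UNIV. g j p * coframe (BetaBar j) p v)}"

definition co_closed :: "('n::finite) form1 \<Rightarrow> bool" where
  "co_closed \<omega> \<longleftrightarrow> (\<forall>f\<in>test_functions. dist_codiff1 (dist_of_form1 \<omega>) f = 0)"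

definition V2_plus :: "('n::finite) form1 set" where
  "V2_plus = {\<omega> \<in> L2_forms1. \<omega> \<in> forms_1_0 \<and> co_closed \<omega>}"

definition V2_minus :: "('n::finite) form1 set" where
  "V2_minus = {\<omega> \<in> L2_forms1. \<omega> \<in> forms_0_1 \<and> co_closed \<omega>}"

end

theory Submission
  imports Defs
begin

text \<open>
  Write \<open>e\<^sub>a\<close> for the unitary frame, \<open>a \<mapsto> bar a\<close> for complex conjugation of its indices, and
  \<open>s\<^sub>b = - \<i>, \<i>, 0\<close> for \<open>b\<close> of type \<open>(1,0)\<close>, \<open>(0,1)\<close> and for \<open>\<theta>\<close>. The formal adjoint of \<open>e\<^sub>a\<close> is minus
  its conjugate, and the only nontrivial brackets are \<open>[e\<^sub>a, e\<^sub>b] = s\<^sub>b T\<close> for \<open>a = bar b\<close>.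
  For a test form \<open>\<phi>\<close> and \<open>b\<close> different from the index of \<open>\<theta>\<close>, commuting derivatives gives
  \<open>(d\<^sup>* d \<phi>)\<^sub>b = (\<Delta>\<^sub>0 + s\<^sub>b T) \<phi>\<^sub>b + e\<^sub>b F\<close>, where the function \<open>F = - d\<^sup>* \<phi> + s\<^sub>b \<phi>\<^sub>\<theta>\<close> depends on
  \<open>b\<close> only through its type. Pairing with a co-closed form of pure type, \<open>e\<^sub>b F\<close>
  contributes \<open>\<langle>\<omega>, d F\<rangle> = 0\<close>, and \<open>d d\<^sup>* \<phi>\<close> likewise contributes \<open>0\<close>.
\<close>

section \<open>Smooth functions and symmetry of second derivatives\<close>

abbreviation pd :: "'a::real_normed_vector \<Rightarrow> ('a \<Rightarrow> 'b::real_normed_vector) \<Rightarrow> 'a \<Rightarrow> 'b" where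
  "pd v f x \<equiv> frechet_derivative f (at x) v"

lemma frechet_derivative_eqI: "(f has_derivative f') (at x) \<Longrightarrow> frechet_derivative f (at x) = f'"
  by (metis frechet_derivative_at)

lemma has_derivative_frechet:
  "f differentiable at x \<Longrightarrow> (f has_derivative frechet_derivative f (at x)) (at x)"
  by (simp add: frechet_derivative_works)

lemma pd_add:
  assumes "f differentiable at x" "g differentiable at x"
  shows "pd v (\<lambda>x. f x + g x) x = pd v f x + pd v g x"
  using frechet_derivative_eqI[OF has_derivative_add[OF assms[THEN has_derivative_frechet]]] by simp

lemma pd_bounded_linear:
  assumes "bounded_linear L" "f differentiable at x"
  shows "pd v (\<lambda>x. L (f x)) x = L (pd v f x)"
  using frechet_derivative_eqI[OF bounded_linear.has_derivative[OF assms(1) assms(2)[THEN has_derivative_frechet]]]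
  by simp

lemma pd_mult:
  fixes f g :: "'a::real_normed_vector \<Rightarrow> complex"
  assumes "f differentiable at x" "g differentiable at x"
  shows "pd v (\<lambda>x. f x * g x) x = f x * pd v g x + pd v f x * g x"
  using frechet_derivative_eqI[OF has_derivative_mult[OF assms[THEN has_derivative_frechet]]] by simp

text \<open>Order \<open>Suc k\<close> does not include continuity by definition; it is recovered at
  the bottom of the recursion, where differentiability implies continuity.\<close>

lemma continuously_differentiable_Suc_imp:
  "continuously_differentiable (Suc k) f \<Longrightarrow> continuously_differentiable k f"
proof (induction k arbitrary: f)
  case 0
  then show ?case
    by (auto intro!: differentiable_imp_continuous_on simp: differentiable_on_def
        intro: differentiable_at_withinI)
next
  case (Suc k)
  then show ?case by (metis continuously_differentiable.simps(2))
qed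

lemma continuously_differentiable_add:
  "continuously_differentiable k f \<Longrightarrow> continuously_differentiable k g \<Longrightarrow>
    continuously_differentiable k (\<lambda>x. f x + g x)"
  by (induction k arbitrary: f g) (auto intro: continuous_on_add simp: pd_add)

lemma continuously_differentiable_bounded_linear:
  assumes L: "bounded_linear L"
  shows "continuously_differentiable k f \<Longrightarrow> continuously_differentiable k (\<lambda>x. L (f x))"
proof (induction k arbitrary: f)
  case 0
  then show ?case using bounded_linear.continuous_on[OF L] by simp
next
  case (Suc k)
  then show ?case
    by (auto simp: pd_bounded_linear[OF L]
        intro: differentiableI[OF bounded_linear.has_derivative[OF L has_derivative_frechet]])
qed

lemma continuously_differentiable_mult:
  fixes f g :: "'a::real_normed_vector \<Rightarrow> complex"
  shows "continuously_differentiable k f \<Longrightarrow> continuously_differentiable k g \<Longrightarrow>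
    continuously_differentiable k (\<lambda>x. f x * g x)"
proof (induction k arbitrary: f g)
  case 0
  then show ?case by (simp add: continuous_on_mult)
next
  case (Suc k)
  \<comment> \<open>The product rule leaves one factor undifferentiated in each term, so the
    regularity of \<open>f\<close> and \<open>g\<close> themselves is lowered to order
    \<open>k\<close> for the induction hypothesis.\<close>
  have fg: "continuously_differentiable k f" "continuously_differentiable k g"
    using Suc.prems by (auto intro: continuously_differentiable_Suc_imp)
  show ?case
    using Suc.prems fg by (auto simp: pd_mult intro!: continuously_differentiable_add Suc.IH)
qed

lemma continuously_differentiable_const: "continuously_differentiable k (\<lambda>x. c)"
  by (induction k arbitrary: c) auto

lemma smooth_add: "smooth f \<Longrightarrow> smooth g \<Longrightarrow> smooth (\<lambda>x. f x + g x)"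
  by (simp add: smooth_def continuously_differentiable_add)

lemma smooth_compose_bounded_linear: "bounded_linear L \<Longrightarrow> smooth f \<Longrightarrow> smooth (\<lambda>x. L (f x))"
  by (simp add: smooth_def continuously_differentiable_bounded_linear)

lemma smooth_mult: "smooth f \<Longrightarrow> smooth g \<Longrightarrow> smooth (\<lambda>x. f x * g x :: complex)"
  by (simp add: smooth_def continuously_differentiable_mult)

lemma smooth_const: "smooth (\<lambda>x. c)"
  by (simp add: smooth_def continuously_differentiable_const)

lemma smooth_pd: "smooth f \<Longrightarrow> smooth (pd v f)"
  unfolding smooth_def by (metis continuously_differentiable.simps(2))

lemma smooth_differentiable: "smooth f \<Longrightarrow> f differentiable at x"
  unfolding smooth_def by (metis continuously_differentiable.simps(2))

lemma smooth_continuous: "smooth f \<Longrightarrow> continuous_on UNIV f"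
  unfolding smooth_def by (metis continuously_differentiable.simps(1))

lemma smooth_bounded_linear:
  assumes "bounded_linear L" shows "smooth L"
proof -
  have "continuously_differentiable k L" for k
  proof (cases k)
    case 0
    then show ?thesis using linear_continuous_on[OF assms] by simp
  next
    case (Suc m)
    have "frechet_derivative L (at x) = L" for x
      by (intro frechet_derivative_eqI bounded_linear_imp_has_derivative assms)
    then show ?thesis
      using Suc bounded_linear_imp_differentiable[OF assms] by (simp add: continuously_differentiable_const)
  qed
  then show ?thesis by (simp add: smooth_def)
qed

section \<open>Equality of mixed derivatives by second differences\<close>

lemma DERIV_along_line:
  fixes f :: "'a::real_normed_vector \<Rightarrow> real"
  assumes "smooth f"
  shows "((\<lambda>r. f (a + r *\<^sub>R u)) has_real_derivative pd u f (a + r *\<^sub>R u)) (at r)"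
proof -
  have "((\<lambda>r. f (a + r *\<^sub>R u)) has_derivative (\<lambda>h. frechet_derivative f (at (a + r *\<^sub>R u)) (0 + h *\<^sub>R u))) (at r)"
    by (rule has_derivative_compose[where g=f and f="\<lambda>r. a + r *\<^sub>R u" and f'="\<lambda>h. 0 + h *\<^sub>R u"])
      (auto intro!: derivative_eq_intros has_derivative_frechet smooth_differentiable assms)
  then show ?thesis
    unfolding has_field_derivative_def
    by (rule has_derivative_eq_rhs)
      (use linear_frechet_derivative[OF smooth_differentiable[OF assms]] in
        \<open>auto simp: fun_eq_iff linear_scale mult.commute\<close>)
qed

text \<open>Two uses of the mean value theorem: first along \<open>u\<close>, for the increment of
  \<open>f\<close> under the shift by \<open>s *\<^sub>R v\<close>, then along \<open>v\<close>, for
  the derivative \<open>pd u f\<close> obtained.\<close>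

lemma second_difference:
  fixes f :: "'a::real_normed_vector \<Rightarrow> real"
  assumes f: "smooth f" and s: "s > 0"
  shows "\<exists>\<xi> \<eta>. 0 < \<xi> \<and> \<xi> < s \<and> 0 < \<eta> \<and> \<eta> < s \<and>
    f (x + s *\<^sub>R u + s *\<^sub>R v) - f (x + s *\<^sub>R u) - f (x + s *\<^sub>R v) + f x
      = s\<^sup>2 * pd v (pd u f) (x + \<xi> *\<^sub>R u + \<eta> *\<^sub>R v)"
proof -
  define g where "g r = f ((x + s *\<^sub>R v) + r *\<^sub>R u) - f (x + r *\<^sub>R u)" for r
  have "(g has_real_derivative (pd u f ((x + s *\<^sub>R v) + r *\<^sub>R u) - pd u f (x + r *\<^sub>R u))) (at r)" for r
    unfolding g_def by (intro DERIV_diff DERIV_along_line f)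
  from MVT2[OF s this] obtain \<xi> where \<xi>: "0 < \<xi>" "\<xi> < s"
    "g s - g 0 = s * (pd u f ((x + s *\<^sub>R v) + \<xi> *\<^sub>R u) - pd u f (x + \<xi> *\<^sub>R u))"
    by auto
  define h where "h r = pd u f ((x + \<xi> *\<^sub>R u) + r *\<^sub>R v)" for r
  have "(h has_real_derivative pd v (pd u f) ((x + \<xi> *\<^sub>R u) + r *\<^sub>R v)) (at r)" for r
    unfolding h_def by (intro DERIV_along_line smooth_pd f)
  from MVT2[OF s this] obtain \<eta> where \<eta>: "0 < \<eta>" "\<eta> < s"
    "h s - h 0 = s * pd v (pd u f) ((x + \<xi> *\<^sub>R u) + \<eta> *\<^sub>R v)"
    by auto
  have "g s - g 0 = s * (h s - h 0)"
    by (simp add: \<xi>(3) h_def add_ac)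
  then show ?thesis
    using \<xi>(1,2) \<eta> by (intro exI[of _ \<xi>] exI[of _ \<eta>]) (simp add: g_def power2_eq_square add_ac)
qed

text \<open>The second difference is symmetric in \<open>u\<close> and \<open>v\<close>. Divided by
  the squared step it tends to either mixed derivative, depending on the direction in which the mean
  value theorem is applied first.\<close>

lemma pd_commute_real:
  fixes f :: "'a::real_normed_vector \<Rightarrow> real"
  assumes f: "smooth f"
  shows "pd u (pd v f) x = pd v (pd u f) x"
proof -
  define s where "s n = inverse (real (Suc n))" for n
  have s: "s n > 0" for n by (simp add: s_def)
  have s0: "s \<longlonglongrightarrow> 0" unfolding s_def by (rule LIMSEQ_inverse_real_of_nat)
  define Q where "Q n = f (x + s n *\<^sub>R u + s n *\<^sub>R v) - f (x + s n *\<^sub>R u) - f (x + s n *\<^sub>R v) + f x" for n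
  \<comment> \<open>The directions are generalized here while \<open>Q\<close> stays fixed, so that
    both orders of \<open>u\<close> and \<open>v\<close> can be inserted.\<close>
  have lim: "(\<lambda>n. Q n / (s n)\<^sup>2) \<longlonglongrightarrow> pd v (pd u f) x"
    if Q: "\<And>n. \<exists>\<xi> \<eta>. 0 < \<xi> \<and> \<xi> < s n \<and> 0 < \<eta> \<and> \<eta> < s n \<and>
      Q n = (s n)\<^sup>2 * pd v (pd u f) (x + \<xi> *\<^sub>R u + \<eta> *\<^sub>R v)" for u v
  proof -
    obtain \<xi> \<eta> where *: "\<And>n. 0 < \<xi> n \<and> \<xi> n < s n \<and> 0 < \<eta> n \<and> \<eta> n < s n \<and>
      Q n = (s n)\<^sup>2 * pd v (pd u f) (x + \<xi> n *\<^sub>R u + \<eta> n *\<^sub>R v)"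
      using Q by metis
    have "\<xi> \<longlonglongrightarrow> 0" "\<eta> \<longlonglongrightarrow> 0"
      by (rule tendsto_sandwich[OF _ _ tendsto_const s0]; use * in \<open>force intro!: always_eventually less_imp_le\<close>)+
    then have "(\<lambda>n. x + \<xi> n *\<^sub>R u + \<eta> n *\<^sub>R v) \<longlonglongrightarrow> x + 0 *\<^sub>R u + 0 *\<^sub>R v"
      by (intro tendsto_intros)
    then have "(\<lambda>n. x + \<xi> n *\<^sub>R u + \<eta> n *\<^sub>R v) \<longlonglongrightarrow> x"
      by simp
    moreover have "isCont (pd v (pd u f)) x"
      using smooth_continuous[OF smooth_pd[OF smooth_pd[OF f]]]
      by (simp add: continuous_on_eq_continuous_at)
    ultimately have "(\<lambda>n. pd v (pd u f) (x + \<xi> n *\<^sub>R u + \<eta> n *\<^sub>R v)) \<longlonglongrightarrow> pd v (pd u f) x"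
      using isCont_tendsto_compose by blast
    moreover have "Q n / (s n)\<^sup>2 = pd v (pd u f) (x + \<xi> n *\<^sub>R u + \<eta> n *\<^sub>R v)" for n
      using *[of n] s[of n] by simp
    ultimately show ?thesis by simp
  qed
  have "(\<lambda>n. Q n / (s n)\<^sup>2) \<longlonglongrightarrow> pd v (pd u f) x"
    by (rule lim) (unfold Q_def, rule second_difference[OF f s])
  moreover have "(\<lambda>n. Q n / (s n)\<^sup>2) \<longlonglongrightarrow> pd u (pd v f) x"
  proof (rule lim)
    show "\<exists>\<xi> \<eta>. 0 < \<xi> \<and> \<xi> < s n \<and> 0 < \<eta> \<and> \<eta> < s n \<and>
      Q n = (s n)\<^sup>2 * pd u (pd v f) (x + \<xi> *\<^sub>R v + \<eta> *\<^sub>R u)" for n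
      using second_difference[OF f s[of n], of x v u] by (simp add: Q_def algebra_simps)
  qed
  ultimately show ?thesis using LIMSEQ_unique by blast
qed

text \<open>The mean value theorem in equality form is restricted to real values, so real and
  imaginary parts are treated separately.\<close>

lemma pd_commute:
  fixes f :: "'a::real_normed_vector \<Rightarrow> complex"
  assumes f: "smooth f"
  shows "pd u (pd v f) x = pd v (pd u f) x"
proof -
  have *: "L (pd u (pd v f) x) = L (pd v (pd u f) x)" if L: "bounded_linear L" for L :: "complex \<Rightarrow> real"
  proof -
    have sL: "smooth (\<lambda>x. L (f x))" using smooth_compose_bounded_linear[OF L f] .
    have "L (pd u (pd v f) x) = pd u (pd v (\<lambda>x. L (f x))) x" for u v
      by (simp add: pd_bounded_linear[OF L] smooth_differentiable f smooth_pd)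
    then show ?thesis using pd_commute_real[OF sL] by metis
  qed
  show ?thesis using *[OF bounded_linear_Re] *[OF bounded_linear_Im] by (rule complex_eqI)
qed

section \<open>Integrals of partial derivatives\<close>

lemma integrable_continuous_bounded_support:
  fixes f :: "'a::euclidean_space \<Rightarrow> 'b::{banach, second_countable_topology}"
  assumes "continuous_on UNIV f" "bounded {x. f x \<noteq> 0}"
  shows "integrable lborel f"
proof -
  obtain R where R: "{x. f x \<noteq> 0} \<subseteq> cball 0 R"
    using bounded_subset_ballD[OF assms(2), of 0] ball_subset_cball by blast
  have "integrable lborel (\<lambda>x. indicator (cball 0 R) x *\<^sub>R f x)"
    using assms(1) by (intro borel_integrable_compact compact_cball) (blast intro: continuous_on_subset)
  moreover have "indicator (cball 0 R) x *\<^sub>R f x = f x" for x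
    using R by (auto simp: indicator_def)
  ultimately show ?thesis by simp
qed

text \<open>Off the closed support \<open>f\<close> vanishes on an open set, hence so does its
  derivative.\<close>

lemma pd_support:
  assumes "pd v f x \<noteq> 0"
  shows "x \<in> closure {x. f x \<noteq> 0}"
proof (rule ccontr)
  assume x: "x \<notin> closure {x. f x \<noteq> 0}"
  then have "frechet_derivative f (at x) = frechet_derivative (\<lambda>x. 0) (at x)"
  proof -
    have "((\<lambda>x. 0) has_derivative (\<lambda>v. 0)) (at x)" by simp
    then have "(f has_derivative (\<lambda>v. 0)) (at x)"
      by (rule has_derivative_transform_within_open[where s="- closure {x. f x \<noteq> 0}"])
        (use x closure_subset[of "{x. f x \<noteq> 0}"] in \<open>auto simp: open_Compl\<close>)
    then show ?thesis by (simp add: frechet_derivative_eqI)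
  qed
  with assms show False by simp
qed

lemma bounded_pd_support:
  assumes "bounded {x. f x \<noteq> 0}"
  shows "bounded {x. pd v f x \<noteq> 0}"
proof (rule bounded_subset[OF bounded_closure[OF assms]])
  show "{x. pd v f x \<noteq> 0} \<subseteq> closure {x. f x \<noteq> 0}"
    using pd_support[where v=v and f=f] by auto
qed

lemma has_vector_derivative_along_line:
  assumes "f differentiable at (a + r *\<^sub>R v)"
  shows "((\<lambda>r. f (a + r *\<^sub>R v)) has_vector_derivative pd v f (a + r *\<^sub>R v)) (at r)"
proof -
  have "((\<lambda>r. f (a + r *\<^sub>R v)) has_derivative (\<lambda>h. frechet_derivative f (at (a + r *\<^sub>R v)) (0 + h *\<^sub>R v))) (at r)"
    by (rule has_derivative_compose[where g=f and f="\<lambda>r. a + r *\<^sub>R v" and f'="\<lambda>h. 0 + h *\<^sub>R v"])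
      (auto intro!: derivative_eq_intros has_derivative_frechet assms)
  then show ?thesis
    unfolding has_vector_derivative_def
    by (rule has_derivative_eq_rhs)
      (use linear_frechet_derivative[OF assms] in \<open>auto simp: fun_eq_iff linear_scale\<close>)
qed

text \<open>
  By translation invariance the difference quotients in direction \<open>v\<close> have integral \<open>0\<close>.
\<close>

lemma integral_pd_eq_0:
  fixes f :: "'a::euclidean_space \<Rightarrow> 'b::{banach, second_countable_topology}"
  assumes diff: "\<And>x. f differentiable at x" and cont: "continuous_on UNIV (pd v f)"
    and bdd: "bounded {x. f x \<noteq> 0}"
  shows "integral\<^sup>L lborel (pd v f) = 0"
proof -
  obtain R where R: "{x. f x \<noteq> 0} \<subseteq> cball 0 R"
    using bounded_subset_ballD[OF bdd, of 0] ball_subset_cball by blast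
  have contf: "continuous_on UNIV f"
    using diff by (auto intro!: differentiable_imp_continuous_on simp: differentiable_on_def
        intro: differentiable_at_withinI)
  have "compact (pd v f ` cball 0 R)"
    using cont by (intro compact_continuous_image) (auto intro: continuous_on_subset)
  then obtain M0 where M0: "\<And>x. x \<in> cball 0 R \<Longrightarrow> norm (pd v f x) \<le> M0"
    by (force dest!: compact_imp_bounded simp: bounded_iff)
  \<comment> \<open>\<open>M0\<close> carries no sign if the ball is empty; the maximum makes the
    bound valid also where the derivative vanishes.\<close>
  define M where "M = max M0 0"
  have M: "norm (pd v f x) \<le> M" for x
  proof (cases "pd v f x = 0")
    case False
    then have "x \<in> cball 0 R"
      using pd_support[OF False] R closure_minimal[OF R] by auto
    then show ?thesis using M0[of x] by (simp add: M_def)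
  qed (auto simp: M_def)
  define s where "s n = inverse (real (Suc n))" for n
  have s: "s n > 0" "s n \<le> 1" for n by (auto simp: s_def field_simps)
  have s0: "s \<longlonglongrightarrow> 0" unfolding s_def by (rule LIMSEQ_inverse_real_of_nat)
  define q where "q n x = (f (x + s n *\<^sub>R v) - f x) /\<^sub>R s n" for n x
  \<comment> \<open>The dominating function: steps satisfy \<open>s n \<le> 1\<close>, so a
    difference quotient can be nonzero only within distance \<open>norm v\<close> of the ball
    containing the support.\<close>
  define w where "w x = M * indicator (cball 0 (R + norm v)) x" for x :: 'a
  have lip: "norm (f (x + r *\<^sub>R v) - f x) \<le> M * r" if "r > 0" for x r
  proof -
    have "norm (f (x + r *\<^sub>R v) - f (x + 0 *\<^sub>R v)) \<le> M * norm (r - 0)"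
    proof (rule differentiable_bound[where S=UNIV and f'="\<lambda>r h. h *\<^sub>R pd v f (x + r *\<^sub>R v)"])
      show "onorm (\<lambda>h. h *\<^sub>R pd v f (x + r *\<^sub>R v)) \<le> M" for r
        by (rule onorm_le) (metis M abs_ge_zero mult.commute mult_right_mono norm_scaleR real_norm_def)
    qed (use has_vector_derivative_along_line[OF diff] in \<open>auto simp: has_vector_derivative_def\<close>)
    then show ?thesis using that by simp
  qed
  have qw: "norm (q n x) \<le> w x" for n x
  proof (cases "x \<in> cball 0 (R + norm v)")
    case True
    have "norm (q n x) \<le> M"
      using lip[OF s(1), of x n] s(1)[of n] by (simp add: q_def divide_simps)
    then show ?thesis using True by (simp add: w_def)
  next
    case False
    have zero: "f y = 0" if "norm y > R" for y
      using that R by auto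
    have x: "norm x > R + norm v" using False by simp
    then have 1: "f x = 0"
      using norm_ge_zero[of v] by (intro zero) linarith
    have "norm x \<le> norm (x + s n *\<^sub>R v) + norm (s n *\<^sub>R v)"
      by (metis add_diff_cancel_right' norm_triangle_ineq4)
    moreover have "norm (s n *\<^sub>R v) \<le> norm v"
      using s[of n] by (simp add: mult_left_le_one_le)
    ultimately have "f (x + s n *\<^sub>R v) = 0"
      using x by (intro zero) linarith
    then show ?thesis using 1 by (simp add: q_def w_def M_def)
  qed
  have lim: "(\<lambda>n. q n x) \<longlonglongrightarrow> pd v f x" for x
  proof -
    have "((\<lambda>r. f (x + r *\<^sub>R v)) has_vector_derivative pd v f x) (at 0)"
      using has_vector_derivative_along_line[OF diff, where a=x and r=0 and v=v] by simp
    then have "((\<lambda>h. norm (f (x + h *\<^sub>R v) - f x - h *\<^sub>R pd v f x) / norm h) \<longlongrightarrow> 0) (at 0)"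
      by (simp add: has_vector_derivative_def has_derivative_iff_norm)
    moreover have "filterlim s (at 0) sequentially"
      using s0 s(1) by (simp add: filterlim_at less_imp_neq[symmetric] eventually_sequentially)
    ultimately have "(\<lambda>n. norm (f (x + s n *\<^sub>R v) - f x - s n *\<^sub>R pd v f x) / norm (s n)) \<longlonglongrightarrow> 0"
      by (rule filterlim_compose)
    moreover have "norm (f (x + s n *\<^sub>R v) - f x - s n *\<^sub>R pd v f x) / norm (s n) = norm (q n x - pd v f x)" for n
    proof -
      have "f (x + s n *\<^sub>R v) - f x - s n *\<^sub>R pd v f x = s n *\<^sub>R (q n x - pd v f x)"
        using s(1)[of n] by (simp add: q_def scaleR_diff_right)
      then show ?thesis using s(1)[of n] by simp
    qed
    ultimately show ?thesis
      by (simp add: tendsto_norm_zero_iff LIM_zero_iff)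
  qed
  have int: "integrable lborel f"
    using contf bdd by (rule integrable_continuous_bounded_support)
  have shift: "integrable lborel (\<lambda>x. f (x + a))" "integral\<^sup>L lborel (\<lambda>x. f (x + a)) = integral\<^sup>L lborel f" for a
  proof -
    have [measurable]: "f \<in> borel_measurable borel" using contf by (rule borel_measurable_continuous_onI)
    show "integrable lborel (\<lambda>x. f (x + a))"
      using int integrable_distr_eq[of "(+) a" lborel borel f]
      by (simp add: lborel_distr_plus add.commute)
    show "integral\<^sup>L lborel (\<lambda>x. f (x + a)) = integral\<^sup>L lborel f"
      using integral_distr[of "(+) a" lborel borel f]
      by (simp add: lborel_distr_plus add.commute)
  qed
  have "integral\<^sup>L lborel (q n) = 0" for n
    unfolding q_def using shift int by (simp add: Bochner_Integration.integral_diff)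
  moreover have "(\<lambda>n. integral\<^sup>L lborel (q n)) \<longlonglongrightarrow> integral\<^sup>L lborel (pd v f)"
  proof (rule integral_dominated_convergence[where w=w])
    show "integrable lborel w"
      unfolding w_def using emeasure_lborel_cball_finite by (intro integrable_mult_right integrable_real_indicator) auto
    show "pd v f \<in> borel_measurable lborel"
      using borel_measurable_continuous_onI[OF cont] by simp
    show "q n \<in> borel_measurable lborel" for n
      unfolding q_def by (intro borel_measurable_integrable integrable_scaleR_right Bochner_Integration.integrable_diff shift(1) int)
  qed (use lim qw in auto)
  ultimately show ?thesis by (simp add: LIMSEQ_const_iff)
qed

section \<open>Test functions and the \<open>L\<^sup>2\<close> pairing\<close>

text \<open>In finite dimension the closure of a set is compact exactly when the set is bounded, and
  boundedness passes easily to sums, products and derivatives.\<close>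

lemma test_functions_iff: "f \<in> test_functions \<longleftrightarrow> smooth f \<and> bounded {p. f p \<noteq> 0}"
  by (simp add: test_functions_def compact_closure)

lemma test_smooth: "f \<in> test_functions \<Longrightarrow> smooth f"
  by (simp add: test_functions_iff)

lemma test_differentiable: "f \<in> test_functions \<Longrightarrow> f differentiable at p"
  by (simp add: test_functions_iff smooth_differentiable)

lemma test_zero: "(\<lambda>p. 0) \<in> test_functions"
  by (simp add: test_functions_iff smooth_const)

lemma test_add:
  assumes "f \<in> test_functions" "g \<in> test_functions"
  shows "(\<lambda>p. f p + g p) \<in> test_functions"
proof -
  have "bounded ({p. f p \<noteq> 0} \<union> {p. g p \<noteq> 0})"
    using assms by (simp add: test_functions_iff)
  then have "bounded {p. f p + g p \<noteq> 0}" by (rule bounded_subset) auto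
  then show ?thesis using assms by (simp add: test_functions_iff smooth_add)
qed

text \<open>Serves also for the coefficients of the frame fields, which are linear and hence not
  compactly supported.\<close>

lemma test_mult_smooth:
  assumes "smooth c" "f \<in> test_functions"
  shows "(\<lambda>p. c p * f p) \<in> test_functions"
proof -
  have "bounded {p. c p * f p \<noteq> 0}"
    using assms(2) by (auto simp: test_functions_iff elim: bounded_subset)
  then show ?thesis using assms by (simp add: test_functions_iff smooth_mult)
qed

lemma test_cmult: "f \<in> test_functions \<Longrightarrow> (\<lambda>p. c * f p) \<in> test_functions"
  by (rule test_mult_smooth[OF smooth_const])

lemma test_uminus: "f \<in> test_functions \<Longrightarrow> (\<lambda>p. - f p) \<in> test_functions"
  using test_cmult[of f "-1"] by simp

lemma test_diff:
  "f \<in> test_functions \<Longrightarrow> g \<in> test_functions \<Longrightarrow> (\<lambda>p. f p - g p) \<in> test_functions"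
  using test_add[OF _ test_uminus, of f g] by simp

lemma test_sum:
  "(\<And>i. i \<in> I \<Longrightarrow> f i \<in> test_functions) \<Longrightarrow> (\<lambda>p. \<Sum>i\<in>I. f i p) \<in> test_functions"
  by (induction I rule: infinite_finite_induct) (auto intro: test_zero test_add)

lemma test_cnj: "f \<in> test_functions \<Longrightarrow> (\<lambda>p. cnj (f p)) \<in> test_functions"
  by (simp add: test_functions_iff smooth_compose_bounded_linear[OF bounded_linear_cnj])

lemma test_pd: "f \<in> test_functions \<Longrightarrow> pd v f \<in> test_functions"
  by (simp add: test_functions_iff smooth_pd bounded_pd_support)

lemma test_measurable:
  "f \<in> test_functions \<Longrightarrow> f \<in> borel_measurable borel"
  by (intro borel_measurable_continuous_onI smooth_continuous test_smooth)

lemma test_integrable: "f \<in> test_functions \<Longrightarrow> integrable lebesgue f"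
  by (subst integrable_completion)
    (auto simp: test_measurable test_functions_iff smooth_continuous
      intro!: integrable_continuous_bounded_support)

lemma test_integral_pd:
  assumes "f \<in> test_functions"
  shows "integral\<^sup>L lebesgue (pd v f) = 0"
proof -
  have "integral\<^sup>L lebesgue (pd v f) = integral\<^sup>L lborel (pd v f)"
    by (rule integral_completion) (simp add: test_measurable test_pd assms)
  also have "\<dots> = 0"
    using assms by (intro integral_pd_eq_0 test_differentiable)
      (simp_all add: test_functions_iff smooth_continuous smooth_pd)
  finally show ?thesis .
qed

lemma test_L2: "f \<in> test_functions \<Longrightarrow> f \<in> L2_functions"
proof -
  assume f: "f \<in> test_functions"
  have "(\<lambda>p. f p * cnj (f p)) \<in> test_functions"
    by (rule test_mult_smooth[OF test_smooth[OF f] test_cnj[OF f]])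
  then have "integrable lebesgue (\<lambda>p. Re (f p * cnj (f p)))"
    by (intro integrable_Re test_integrable)
  moreover have "Re (f p * cnj (f p)) = (cmod (f p))\<^sup>2" for p
    by (simp add: complex_mult_cnj cmod_power2)
  moreover have "f \<in> borel_measurable lebesgue"
    using test_measurable[OF f] by (simp add: measurable_completion)
  ultimately show ?thesis by (simp add: L2_functions_def)
qed

text \<open>Dominated by the sum of the two squared moduli, since
  \<open>2 * a * b \<le> a\<^sup>2 + b\<^sup>2\<close>.\<close>

lemma L2_mult_cnj_integrable:
  assumes f: "f \<in> L2_functions" and g: "g \<in> L2_functions"
  shows "integrable lebesgue (\<lambda>p. f p * cnj (g p))"
proof (rule Bochner_Integration.integrable_bound)
  show "integrable lebesgue (\<lambda>p. (cmod (f p))\<^sup>2 + (cmod (g p))\<^sup>2)"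
    using f g by (auto simp: L2_functions_def)
  have "f \<in> borel_measurable lebesgue" "g \<in> borel_measurable lebesgue"
    using f g by (auto simp: L2_functions_def)
  moreover from this(2) have "(\<lambda>p. cnj (g p)) \<in> borel_measurable lebesgue"
    by (rule borel_measurable_continuous_on[rotated]) (intro continuous_intros)
  ultimately show "(\<lambda>p. f p * cnj (g p)) \<in> borel_measurable lebesgue"
    by (intro borel_measurable_times)
  have "norm (f p * cnj (g p)) \<le> norm ((cmod (f p))\<^sup>2 + (cmod (g p))\<^sup>2)" for p
  proof -
    have "2 * (cmod (f p) * cmod (g p)) \<le> (cmod (f p))\<^sup>2 + (cmod (g p))\<^sup>2"
      using sum_squares_bound[of "cmod (f p)" "cmod (g p)"] by simp
    moreover have "0 \<le> cmod (f p) * cmod (g p)" by simp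
    ultimately have "cmod (f p) * cmod (g p) \<le> (cmod (f p))\<^sup>2 + (cmod (g p))\<^sup>2"
      by linarith
    then show ?thesis by (simp add: norm_mult)
  qed
  then show "AE p in lebesgue. norm (f p * cnj (g p)) \<le> norm ((cmod (f p))\<^sup>2 + (cmod (g p))\<^sup>2)"
    by simp
qed

section \<open>Sesquilinearity and definiteness of the pairing\<close>

context
  fixes w :: "('n::finite) heis \<Rightarrow> complex"
  assumes w: "w \<in> L2_functions"
begin

lemma pair0_add_right:
  "f \<in> test_functions \<Longrightarrow> g \<in> test_functions \<Longrightarrow>
    pair0 w (\<lambda>p. f p + g p) = pair0 w f + pair0 w g"
  unfolding pair0_def
  by (subst Bochner_Integration.integral_add[symmetric])
    (auto simp: algebra_simps intro!: L2_mult_cnj_integrable w test_L2)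

lemma pair0_cmult_right: "pair0 w (\<lambda>p. c * f p) = cnj c * pair0 w f"
  unfolding pair0_def by (subst integral_mult_right_zero[symmetric]) (simp add: mult_ac)

lemma pair0_uminus_right: "pair0 w (\<lambda>p. - f p) = - pair0 w f"
  using pair0_cmult_right[of "-1" f] by simp

lemma pair0_diff_right:
  "f \<in> test_functions \<Longrightarrow> g \<in> test_functions \<Longrightarrow>
    pair0 w (\<lambda>p. f p - g p) = pair0 w f - pair0 w g"
  using pair0_add_right[OF _ test_uminus, of f g] by (simp add: pair0_uminus_right)

lemma pair0_zero_right: "pair0 w (\<lambda>p. 0) = 0"
  by (simp add: pair0_def)

lemma pair0_sum_right:
  "(\<And>i. i \<in> I \<Longrightarrow> f i \<in> test_functions) \<Longrightarrow>
    pair0 w (\<lambda>p. \<Sum>i\<in>I. f i p) = (\<Sum>i\<in>I. pair0 w (f i))"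
  by (induction I rule: infinite_finite_induct)
    (auto simp: pair0_zero_right pair0_add_right test_sum)

end

text \<open>Hermitian symmetry; it carries the rules for the second argument over to the
  first.\<close>

lemma pair0_cnj: "pair0 g f = cnj (pair0 f g)"
  unfolding pair0_def by (subst Bochner_Integration.integral_cnj[symmetric]) (simp add: mult.commute)

lemma pair0_add_left:
  "f \<in> test_functions \<Longrightarrow> g \<in> test_functions \<Longrightarrow> h \<in> test_functions \<Longrightarrow>
    pair0 (\<lambda>p. f p + g p) h = pair0 f h + pair0 g h"
  by (simp add: pair0_cnj[of _ h] pair0_add_right test_L2)

lemma pair0_cmult_left: "pair0 (\<lambda>p. c * f p) h = c * pair0 f h"
  unfolding pair0_def by (subst integral_mult_right_zero[symmetric]) (simp add: mult_ac)

lemma pair0_uminus_left: "pair0 (\<lambda>p. - f p) h = - pair0 f h"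
  using pair0_cmult_left[of "-1" f] by simp

lemma pair0_diff_left:
  "f \<in> test_functions \<Longrightarrow> g \<in> test_functions \<Longrightarrow> h \<in> test_functions \<Longrightarrow>
    pair0 (\<lambda>p. f p - g p) h = pair0 f h - pair0 g h"
  using pair0_add_left[OF _ test_uminus, of f g h] by (simp add: pair0_uminus_left)

lemma pair0_sum_left:
  "(\<And>i. i \<in> I \<Longrightarrow> f i \<in> test_functions) \<Longrightarrow> h \<in> test_functions \<Longrightarrow>
    pair0 (\<lambda>p. \<Sum>i\<in>I. f i p) h = (\<Sum>i\<in>I. pair0 (f i) h)"
  by (simp add: pair0_cnj[of _ h] pair0_sum_right test_L2)

text \<open>The integral of the squared modulus vanishes, so \<open>f\<close> is zero almost
  everywhere. The set where it is nonzero is open and null, hence empty. This definiteness makes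
  formal adjoints unique.\<close>

lemma pair0_self_eq_0:
  assumes f: "f \<in> test_functions" and 0: "pair0 f f = 0"
  shows "f = (\<lambda>p. 0)"
proof -
  have int: "integrable lebesgue (\<lambda>p. (cmod (f p))\<^sup>2)"
    using test_L2[OF f] by (simp add: L2_functions_def)
  have "pair0 f f = integral\<^sup>L lebesgue (\<lambda>p. complex_of_real ((cmod (f p))\<^sup>2))"
    unfolding pair0_def by (simp only: complex_norm_square)
  also have "\<dots> = complex_of_real (integral\<^sup>L lebesgue (\<lambda>p. (cmod (f p))\<^sup>2))"
    by (rule integral_complex_of_real)
  finally have "integral\<^sup>L lebesgue (\<lambda>p. (cmod (f p))\<^sup>2) = 0" using 0 by simp
  then have "AE p in lebesgue. (cmod (f p))\<^sup>2 = 0"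
    using integral_nonneg_eq_0_iff_AE[OF int] by simp
  then have ae: "AE p in lebesgue. f p = 0" by simp
  have op: "open {p. f p \<noteq> 0}"
    using smooth_continuous[OF test_smooth[OF f]]
    by (intro open_Collect_neq) (auto intro: continuous_intros)
  then have sets: "{p. f p \<noteq> 0} \<in> sets lebesgue"
    by (intro sets_completionI_sets) simp
  have "{p. f p \<noteq> 0} \<in> null_sets lebesgue"
    using ae AE_iff_measurable[OF sets, of "\<lambda>p. f p = 0"] sets by (simp add: null_sets_def)
  with op have "{p. f p \<noteq> 0} = {}"
    using open_not_negligible negligible_iff_null_sets by blast
  then show ?thesis by auto
qed

section \<open>The unitary frame\<close>

fun bar :: "'n frame_index \<Rightarrow> 'n frame_index" where
  "bar (Beta j) = BetaBar j"
| "bar (BetaBar j) = Beta j"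
| "bar Theta = Theta"

lemma bar_bar [simp]: "bar (bar a) = a"
  by (cases a) auto

text \<open>The constants \<open>s\<^sub>b\<close>: the bracket of the conjugate of
  \<open>e\<^sub>b\<close> with \<open>e\<^sub>b\<close> is \<open>s\<^sub>b T\<close>, as follows
  from \<open>[X\<^sub>j, Y\<^sub>j] = T\<close>.\<close>

fun bar_bracket :: "'n frame_index \<Rightarrow> complex" where
  "bar_bracket (Beta j) = - \<i>"
| "bar_bracket (BetaBar j) = \<i>"
| "bar_bracket Theta = 0"

text \<open>The structure constants: \<open>[e\<^sub>a, e\<^sub>b]\<close> is this multiple of
  \<open>T\<close>.\<close>

definition bracket_coeff :: "'n frame_index \<Rightarrow> 'n frame_index \<Rightarrow> complex" where
  "bracket_coeff a b = (if a = bar b then bar_bracket b else 0)"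

text \<open>
  The coefficient of \<open>\<partial>\<^sub>t\<close> in \<open>e\<^sub>a\<close>, minus its value at the origin.
\<close>

fun vcoef :: "('n::finite) frame_index \<Rightarrow> 'n heis \<Rightarrow> complex" where
  "vcoef (Beta j) p =
     Complex (- (fst (snd p) $ j) / (2 * sqrt 2)) (- (fst p $ j) / (2 * sqrt 2))"
| "vcoef (BetaBar j) p =
     Complex (- (fst (snd p) $ j) / (2 * sqrt 2)) (fst p $ j / (2 * sqrt 2))"
| "vcoef Theta p = 0"

text \<open>Moving the base point changes a frame vector only in the direction of \<open>T\<close>.
  As complex vectors are encoded as pairs, real and imaginary part of the coefficient go to separate
  slots.\<close>

lemma frame_affine:
  "frame a p = (fst (frame a 0) + Re (vcoef a p) *\<^sub>R (0, 0, 1),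
                snd (frame a 0) + Im (vcoef a p) *\<^sub>R (0, 0, 1))"
  by (cases a; cases p) (auto simp: X_field_def Y_field_def T_field_def zero_prod_def)

lemma frame_bar: "frame (bar a) p = (fst (frame a p), - snd (frame a p))"
  by (cases a) auto

lemma linear_vcoef: "linear (vcoef a)"
  by (cases a) (auto intro!: linearI simp: complex_eq_iff field_simps)

lemma bounded_linear_vcoef: "bounded_linear (vcoef a)"
  using linear_vcoef linear_conv_bounded_linear by blast

lemma pd_vcoef: "pd v (vcoef a) p = vcoef a v"
  by (simp add: frechet_derivative_eqI[OF bounded_linear_imp_has_derivative[OF bounded_linear_vcoef]])

lemma smooth_vcoef: "smooth (vcoef a)"
  by (rule smooth_bounded_linear[OF bounded_linear_vcoef])

text \<open>The left side is the \<open>t\<close> component of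
  \<open>[e\<^sub>a, e\<^sub>b]\<close>. All other components of the frame fields are constant and
  contribute nothing to the bracket.\<close>

lemma ceval_vcoef_bracket:
  "ceval (vcoef b) (frame a p) - ceval (vcoef a) (frame b p) = bracket_coeff a b"
  by (cases a; cases b; cases p)
    (auto simp: ceval_def X_field_def Y_field_def T_field_def bracket_coeff_def complex_eq_iff axis_def)

section \<open>Derivatives along the frame, their commutators and adjoints\<close>

definition fderiv :: "('n::finite) frame_index \<Rightarrow> ('n heis \<Rightarrow> complex) \<Rightarrow> 'n heis \<Rightarrow> complex" where
  "fderiv a f p = ceval (frechet_derivative f (at p)) (frame a p)"

text \<open>Splits \<open>e\<^sub>a\<close> into derivatives in constant directions and one variable
  multiple of the \<open>t\<close> derivative, so that the rules for \<open>pd\<close>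
  apply.\<close>

lemma fderiv_eq:
  assumes "f differentiable at p"
  shows "fderiv a f p =
    pd (fst (frame a 0)) f p + \<i> * pd (snd (frame a 0)) f p + vcoef a p * pd (0, 0, 1) f p"
proof -
  interpret linear "frechet_derivative f (at p)"
    by (rule linear_frechet_derivative[OF assms])
  have *: "pd (u + r *\<^sub>R (0, 0, 1)) f p = pd u f p + complex_of_real r * pd (0, 0, 1) f p" for u r
    by (simp only: add scale scaleR_conv_of_real)
  have "fderiv a f p = pd (fst (frame a 0)) f p + \<i> * pd (snd (frame a 0)) f p
      + (complex_of_real (Re (vcoef a p)) + \<i> * complex_of_real (Im (vcoef a p))) * pd (0, 0, 1) f p"
    unfolding fderiv_def
    by (subst frame_affine) (simp only: ceval_def fst_conv snd_conv * algebra_simps)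
  then show ?thesis
    by (simp only: complex_eq[symmetric])
qed

lemma fderiv_test:
  assumes f: "f \<in> test_functions"
  shows "fderiv a f \<in> test_functions"
proof -
  have "fderiv a f = (\<lambda>p. pd (fst (frame a 0)) f p + \<i> * pd (snd (frame a 0)) f p
      + vcoef a p * pd (0, 0, 1) f p)"
    by (intro ext fderiv_eq test_differentiable f)
  then show ?thesis
    using f by (simp add: test_add test_cmult test_pd test_mult_smooth smooth_vcoef)
qed

lemma fderiv_add:
  "f \<in> test_functions \<Longrightarrow> g \<in> test_functions \<Longrightarrow>
    fderiv a (\<lambda>p. f p + g p) p = fderiv a f p + fderiv a g p"
  by (simp add: fderiv_def ceval_def pd_add test_differentiable algebra_simps)

lemma fderiv_cmult:
  "f \<in> test_functions \<Longrightarrow> fderiv a (\<lambda>p. c * f p) p = c * fderiv a f p"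
  by (simp add: fderiv_def ceval_def pd_bounded_linear[OF bounded_linear_mult_right]
      test_differentiable algebra_simps)

lemma fderiv_uminus:
  "f \<in> test_functions \<Longrightarrow> fderiv a (\<lambda>p. - f p) p = - fderiv a f p"
  using fderiv_cmult[of f a "-1"] by simp

lemma fderiv_diff:
  "f \<in> test_functions \<Longrightarrow> g \<in> test_functions \<Longrightarrow>
    fderiv a (\<lambda>p. f p - g p) p = fderiv a f p - fderiv a g p"
  using fderiv_add[OF _ test_uminus, of f g] by (simp add: fderiv_uminus)

lemma fderiv_zero: "fderiv a (\<lambda>p. 0) p = 0"
  by (simp add: fderiv_def ceval_def)

lemma fderiv_sum:
  "(\<And>i. i \<in> I \<Longrightarrow> f i \<in> test_functions) \<Longrightarrow>
    fderiv a (\<lambda>p. \<Sum>i\<in>I. f i p) p = (\<Sum>i\<in>I. fderiv a (f i) p)"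
  by (induction I rule: infinite_finite_induct) (auto simp: fderiv_zero fderiv_add test_sum)

text \<open>Leibniz rule; differentiating a conjugate along \<open>e\<^sub>a\<close> is conjugating
  the derivative along the conjugate field, whence \<open>bar a\<close>.\<close>

lemma fderiv_mult_cnj:
  assumes "f \<in> test_functions" "g \<in> test_functions"
  shows "fderiv a (\<lambda>p. f p * cnj (g p)) p = fderiv a f p * cnj (g p) + f p * cnj (fderiv (bar a) g p)"
  using assms
  by (simp add: fderiv_def ceval_def frame_bar pd_mult test_differentiable test_cnj
      pd_bounded_linear[OF bounded_linear_cnj] linear_neg linear_frechet_derivative algebra_simps)

text \<open>Constant directions commute with each other. The extra term is the derivative of the
  variable coefficient, which is linear and so its own derivative.\<close>

lemma pd_fderiv:
  assumes f: "f \<in> test_functions"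
  shows "pd v (fderiv a f) p = fderiv a (pd v f) p + vcoef a v * pd (0, 0, 1) f p"
proof -
  have "fderiv a f = (\<lambda>p. pd (fst (frame a 0)) f p + \<i> * pd (snd (frame a 0)) f p
      + vcoef a p * pd (0, 0, 1) f p)"
    by (intro ext fderiv_eq test_differentiable f)
  then show ?thesis
    by (simp add: fderiv_eq pd_add pd_mult pd_bounded_linear[OF bounded_linear_mult_right]
        test_differentiable test_add test_cmult test_pd test_mult_smooth smooth_vcoef f
        smooth_differentiable pd_vcoef pd_commute[OF test_smooth[OF f], of v])
qed

text \<open>The second-order parts cancel by symmetry of second derivatives; what is left is the
  \<open>t\<close> component of the bracket times the \<open>t\<close> derivative.\<close>

lemma fderiv_commutator:
  assumes f: "f \<in> test_functions"
  shows "fderiv a (fderiv b f) p = fderiv b (fderiv a f) p + bracket_coeff a b * fderiv Theta f p"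
proof -
  \<comment> \<open>The first summand has both frame vectors frozen at \<open>p\<close>; in the
    second, \<open>e\<^sub>a\<close> differentiates the coefficient of
    \<open>e\<^sub>b\<close>.\<close>
  have *: "fderiv a (fderiv b f) p
    = ceval (\<lambda>v. ceval (\<lambda>w. pd w (pd v f) p) (frame b p)) (frame a p)
      + ceval (vcoef b) (frame a p) * pd (0, 0, 1) f p" for a b
    unfolding fderiv_def[of a]
    by (simp add: ceval_def pd_fderiv[OF f] algebra_simps) (simp add: fderiv_def ceval_def algebra_simps)
  have "fderiv a (fderiv b f) p - fderiv b (fderiv a f) p
    = (ceval (vcoef b) (frame a p) - ceval (vcoef a) (frame b p)) * pd (0, 0, 1) f p"
    unfolding * by (simp add: ceval_def pd_commute[OF test_smooth[OF f], of "fst (frame a p)"]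
      pd_commute[OF test_smooth[OF f], of "snd (frame a p)"] algebra_simps)
  moreover have "fderiv Theta f p = pd (0, 0, 1) f p"
    using linear_0[OF linear_frechet_derivative[OF test_differentiable[OF f]], of p]
    by (simp add: fderiv_def ceval_def T_field_def)
  ultimately show ?thesis
    by (simp add: ceval_vcoef_bracket algebra_simps)
qed

text \<open>
  The only non-constant coefficient of \<open>e\<^sub>a\<close> is the coefficient of \<open>\<partial>\<^sub>t\<close>, which does not depend on \<open>t\<close>,
  so \<open>e\<^sub>a f\<close> is a sum of partial derivatives.
\<close>

lemma integral_fderiv:
  assumes f: "f \<in> test_functions"
  shows "integral\<^sup>L lebesgue (fderiv a f) = 0"
proof -
  let ?g = "\<lambda>p. vcoef a p * f p"
  have g: "?g \<in> test_functions" by (rule test_mult_smooth[OF smooth_vcoef f])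
  have "vcoef a (0, 0, 1) = 0" by (cases a) (auto simp: complex_eq_iff)
  then have "pd (0, 0, 1) ?g p = vcoef a p * pd (0, 0, 1) f p" for p
    by (simp add: pd_mult test_differentiable[OF f] smooth_differentiable[OF smooth_vcoef] pd_vcoef)
  then have "fderiv a f = (\<lambda>p. pd (fst (frame a 0)) f p + \<i> * pd (snd (frame a 0)) f p + pd (0, 0, 1) ?g p)"
    by (auto simp: fun_eq_iff fderiv_eq[OF test_differentiable[OF f]])
  then show ?thesis
    by (simp add: test_integrable test_pd f g test_integral_pd)
qed

text \<open>Integration by parts: the derivative of \<open>f * cnj g\<close> along the conjugate
  field has integral zero.\<close>

lemma pair0_fderiv:
  assumes f: "f \<in> test_functions" and g: "g \<in> test_functions"
  shows "pair0 f (fderiv a g) = - pair0 (fderiv (bar a) f) g"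
proof -
  have fg: "(\<lambda>p. f p * cnj (g p)) \<in> test_functions"
    by (rule test_mult_smooth[OF test_smooth[OF f] test_cnj[OF g]])
  have "fderiv (bar a) (\<lambda>p. f p * cnj (g p)) = (\<lambda>p. fderiv (bar a) f p * cnj (g p) + f p * cnj (fderiv a g p))"
    by (rule ext) (simp add: fderiv_mult_cnj[OF f g])
  then have "0 = integral\<^sup>L lebesgue (\<lambda>p. fderiv (bar a) f p * cnj (g p) + f p * cnj (fderiv a g p))"
    using integral_fderiv[OF fg, of "bar a"] by simp
  also have "\<dots> = pair0 (fderiv (bar a) f) g + pair0 f (fderiv a g)"
    unfolding pair0_def
    by (intro Bochner_Integration.integral_add L2_mult_cnj_integrable test_L2 fderiv_test f g)
  finally show ?thesis by (simp add: eq_neg_iff_add_eq_0 add.commute)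
qed

section \<open>Duality of frame and coframe\<close>

lemma ceval_coframe: "ceval (coframe a p) (frame b p) = (if a = b then 1 else 0)"
  by (cases a; cases b; cases p)
    (auto simp: ceval_def dx_def dy_def dt_def theta_def X_field_def Y_field_def T_field_def axis_def
      complex_eq_iff if_distrib if_distribR sum.delta cong: if_cong)

lemma ceval_sum: "ceval (\<lambda>v. \<Sum>i\<in>I. f i v) Z = (\<Sum>i\<in>I. ceval (f i) Z)"
  by (simp add: ceval_def sum.distrib sum_distrib_left)

lemma ceval_cmult: "ceval (\<lambda>v. c * f v) Z = c * ceval f Z"
  by (simp add: ceval_def algebra_simps)

lemma coeff1_form_of [simp]: "coeff1 (form_of c) a = c a"
  by (rule ext) (simp add: coeff1_def form_of_def ceval_sum ceval_cmult ceval_coframe if_distrib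
      sum.delta cong: if_cong)

lemma coeff1_ext_d0: "coeff1 (ext_d0 f) a = fderiv a f"
  by (rule ext) (simp add: coeff1_def ext_d0_def fderiv_def)

section \<open>The codifferentials on test forms\<close>

text \<open>\<open>d\<theta> = - symplectic\<close>\<close>

definition symplectic :: "('n::finite) heis \<Rightarrow> 'n heis \<Rightarrow> real" where
  "symplectic v w = (\<Sum>j\<in>UNIV. fst v $ j * fst (snd w) $ j - fst (snd v) $ j * fst w $ j)"

text \<open>For fixed \<open>w\<close>, \<open>theta q w\<close> is a constant plus a function
  linear in the base point \<open>q\<close>, and that linear part is the derivative.\<close>

lemma has_derivative_theta:
  "((\<lambda>q. theta q w) has_derivative (\<lambda>v. - (complex_of_real (symplectic v w) / 2))) (at p)"
proof -
  have "linear (\<lambda>q. - (complex_of_real (symplectic q w) / 2))"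
  proof (rule linearI)
    show "- (complex_of_real (symplectic (q + q') w) / 2)
        = - (complex_of_real (symplectic q w) / 2) + - (complex_of_real (symplectic q' w) / 2)" for q q'
      by (simp add: symplectic_def sum.distrib sum_subtractf algebra_simps add_divide_distrib diff_divide_distrib)
    have "symplectic (r *\<^sub>R q) w = r * symplectic q w" for r q
      by (simp add: symplectic_def sum_distrib_left right_diff_distrib mult.assoc)
    then show "- (complex_of_real (symplectic (r *\<^sub>R q) w) / 2)
        = r *\<^sub>R - (complex_of_real (symplectic q w) / 2)" for r q
      by (simp add: scaleR_conv_of_real)
  qed
  then have bl: "bounded_linear (\<lambda>q. - (complex_of_real (symplectic q w) / 2))"
    by (simp only: linear_conv_bounded_linear)
  have "theta q w = dt q w + - (complex_of_real (symplectic q w) / 2)" for q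
    by (simp add: theta_def dx_def dy_def symplectic_def)
  moreover have "dt q w = dt p w" for q
    by (simp add: dt_def)
  ultimately have "(\<lambda>q. theta q w) = (\<lambda>q. dt p w + - (complex_of_real (symplectic q w) / 2))"
    by (simp add: fun_eq_iff)
  then show ?thesis
    using has_derivative_add[OF has_derivative_const bounded_linear_imp_has_derivative[OF bl]] by simp
qed

lemma has_derivative_coframe:
  "((\<lambda>q. coframe a q w) has_derivative
     (\<lambda>v. if a = Theta then - (complex_of_real (symplectic v w) / 2) else 0)) (at p)"
  by (cases a) (auto simp: has_derivative_theta dx_def dy_def)

lemma sum_mult_delta:
  fixes f g :: "'a::finite \<Rightarrow> 'b::semiring_1"
  shows "(\<Sum>a\<in>UNIV. f a * (if a = b then g a else 0)) = f b * g b"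
  by (simp add: if_distrib[of "(*) _"] sum.delta cong: if_cong)

text \<open>Leibniz rule; among the coframe only \<theta> varies with the base point, which produces
  the symplectic term.\<close>

lemma pd_form_of:
  assumes c: "\<And>a. c a \<in> test_functions"
  shows "pd v (\<lambda>q. form_of c q w) p =
    (\<Sum>a\<in>UNIV. pd v (c a) p * coframe a p w) - c Theta p * complex_of_real (symplectic v w) / 2"
proof -
  have "((\<lambda>q. form_of c q w) has_derivative
     (\<lambda>v. \<Sum>a\<in>UNIV. c a p * (if a = Theta then - (complex_of_real (symplectic v w) / 2) else 0)
       + pd v (c a) p * coframe a p w)) (at p)"
    unfolding form_of_def
    by (intro has_derivative_sum has_derivative_mult has_derivative_coframe has_derivative_frechet
        test_differentiable c)
  from frechet_derivative_eqI[OF this] show ?thesis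
    by (simp add: sum.distrib sum_mult_delta)
qed

text \<open>The structure constants reappear because \<open>d\<theta>(e\<^sub>a, e\<^sub>b) = -
  \<theta>([e\<^sub>a, e\<^sub>b])\<close>.\<close>

lemma ceval_symplectic: "ceval (\<lambda>v. ceval (\<lambda>w. complex_of_real (symplectic v w)) (frame b p)) (frame a p)
    = bracket_coeff a b"
  by (cases a; cases b; cases p)
    (auto simp: ceval_def symplectic_def X_field_def Y_field_def T_field_def bracket_coeff_def axis_def
      complex_eq_iff if_distrib if_distribR sum_subtractf sum_negf sum.delta cong: if_cong)

lemma symplectic_antisym: "symplectic w v = - symplectic v w"
  by (simp add: symplectic_def sum_negf[symmetric] mult.commute)

lemma ceval_diff: "ceval (\<lambda>v. f v - g v) Z = ceval f Z - ceval g Z"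
  by (simp add: ceval_def algebra_simps)

lemma ceval_mult_right: "ceval (\<lambda>v. f v * c) Z = ceval f Z * c"
  by (simp add: ceval_def algebra_simps)

lemma coeff2_ext_d1:
  assumes c: "\<And>a. c a \<in> test_functions"
  shows "coeff2 (ext_d1 (form_of c)) a b p =
    fderiv a (c b) p - fderiv b (c a) p - bracket_coeff a b * c Theta p"
proof -
  \<comment> \<open>Antisymmetrization adds the two halves of the symplectic term to a whole
    one.\<close>
  have "ext_d1 (form_of c) p v w =
      (\<Sum>e\<in>UNIV. pd v (c e) p * coframe e p w) - (\<Sum>e\<in>UNIV. pd w (c e) p * coframe e p v)
      - c Theta p * complex_of_real (symplectic v w)" for v w
    by (simp add: ext_d1_def pd_form_of[OF c] symplectic_antisym[of w v] field_simps)
  then have "ext_d1 (form_of c) p = (\<lambda>v w.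
      (\<Sum>e\<in>UNIV. pd v (c e) p * coframe e p w) - (\<Sum>e\<in>UNIV. pd w (c e) p * coframe e p v)
      - c Theta p * complex_of_real (symplectic v w))"
    by (intro ext)
  then have "coeff2 (ext_d1 (form_of c)) a b p = ceval (\<lambda>v. ceval (\<lambda>w.
      (\<Sum>e\<in>UNIV. pd v (c e) p * coframe e p w) - (\<Sum>e\<in>UNIV. pd w (c e) p * coframe e p v)
      - c Theta p * complex_of_real (symplectic v w)) (frame b p)) (frame a p)"
    by (simp only: coeff2_def)
  also have "\<dots> = (\<Sum>e\<in>UNIV. fderiv a (c e) p * ceval (coframe e p) (frame b p))
      - (\<Sum>e\<in>UNIV. fderiv b (c e) p * ceval (coframe e p) (frame a p))
      - c Theta p * ceval (\<lambda>v. ceval (\<lambda>w. complex_of_real (symplectic v w)) (frame b p)) (frame a p)"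
    by (simp only: ceval_diff ceval_sum ceval_cmult ceval_mult_right fderiv_def)
  also have "\<dots> = fderiv a (c b) p - fderiv b (c a) p - bracket_coeff a b * c Theta p"
    by (simp add: ceval_coframe ceval_symplectic sum_mult_delta mult.commute[of "c Theta p"])
  finally show ?thesis .
qed

text \<open>Only the coefficients of the second form are prescribed, so that it applies to forms not
  written with \<open>form_of\<close>, such as \<open>ext_d0 f\<close>.\<close>

lemma pair1_form_of:
  fixes w c :: "('n::finite) frame_index \<Rightarrow> 'n heis \<Rightarrow> complex"
  assumes "\<And>a. w a \<in> L2_functions" "\<And>a. c a \<in> L2_functions"
    and "\<And>a. coeff1 \<phi> a = c a"
  shows "pair1 (form_of w) \<phi> = (\<Sum>a\<in>UNIV. pair0 (w a) (c a))"
  unfolding pair1_def pair0_def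
  by (simp add: assms(3) Bochner_Integration.integral_sum L2_mult_cnj_integrable assms(1,2))

text \<open>The last assumption is the nondegeneracy of the pairing, needed for the definite
  description to denote.\<close>

lemma formal_adjoint_eqI:
  assumes "\<alpha> \<in> A" "\<And>\<phi>. \<phi> \<in> A \<Longrightarrow> ipA \<alpha> \<phi> = ipB \<psi> (D \<phi>)"
    and "\<And>\<beta>. \<beta> \<in> A \<Longrightarrow> (\<And>\<phi>. \<phi> \<in> A \<Longrightarrow> ipA \<beta> \<phi> = ipA \<alpha> \<phi>) \<Longrightarrow> \<beta> = \<alpha>"
  shows "formal_adjoint A ipA ipB D \<psi> = \<alpha>"
  unfolding formal_adjoint_def
proof (rule the_equality)
  show "\<alpha> \<in> A \<and> (\<forall>\<phi>\<in>A. ipA \<alpha> \<phi> = ipB \<psi> (D \<phi>))"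
    using assms(1,2) by blast
  show "\<beta> = \<alpha>" if "\<beta> \<in> A \<and> (\<forall>\<phi>\<in>A. ipA \<beta> \<phi> = ipB \<psi> (D \<phi>))" for \<beta>
    by (rule assms(3)) (simp_all add: that assms(2))
qed

lemma test_eqI_pair0:
  assumes "f \<in> test_functions" "g \<in> test_functions"
    and "\<And>h. h \<in> test_functions \<Longrightarrow> pair0 f h = pair0 g h"
  shows "f = g"
proof -
  have t: "(\<lambda>p. f p - g p) \<in> test_functions" by (rule test_diff[OF assms(1,2)])
  have "pair0 (\<lambda>p. f p - g p) (\<lambda>p. f p - g p) = 0"
    using pair0_diff_left[OF assms(1,2) t] assms(3)[OF t] by simp
  from pair0_self_eq_0[OF t this] show ?thesis by (auto simp: fun_eq_iff)
qed

text \<open>The coefficients of \<open>d f\<close> are the frame derivatives of \<open>f\<close>,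
  and the formal adjoint of \<open>fderiv a\<close> is \<open>- fderiv (bar a)\<close>.\<close>

lemma codiff1_form_of:
  assumes c: "\<And>a. c a \<in> test_functions"
  shows "codiff1 (form_of c) = (\<lambda>p. - (\<Sum>a\<in>UNIV. fderiv (bar a) (c a) p))"
  unfolding codiff1_def
proof (rule formal_adjoint_eqI)
  let ?\<alpha> = "\<lambda>p. - (\<Sum>a\<in>UNIV. fderiv (bar a) (c a) p)"
  show \<alpha>: "?\<alpha> \<in> test_functions"
    by (intro test_uminus test_sum fderiv_test c)
  show "pair0 ?\<alpha> f = pair1 (form_of c) (ext_d0 f)" if "f \<in> test_functions" for f
  proof -
    have "pair1 (form_of c) (ext_d0 f) = (\<Sum>a\<in>UNIV. pair0 (c a) (fderiv a f))"
      by (rule pair1_form_of) (auto intro: test_L2 c fderiv_test that simp: coeff1_ext_d0)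
    then show ?thesis
      by (simp add: pair0_fderiv c that pair0_uminus_left pair0_sum_left fderiv_test sum_negf)
  qed
  show "\<beta> = ?\<alpha>" if "\<beta> \<in> test_functions" "\<And>f. f \<in> test_functions \<Longrightarrow> pair0 \<beta> f = pair0 ?\<alpha> f" for \<beta>
    by (rule test_eqI_pair0[OF that(1) \<alpha> that(2)])
qed

text \<open>
  The coefficients of \<open>d\<^sup>* \<psi>\<close> for a 2-form with antisymmetric coefficients \<open>P\<close>; the \<open>\<theta>\<close> component
  has an extra term because \<open>d\<theta>\<close> does not vanish.
\<close>

definition codiff_coeff ::
  "(('n::finite) frame_index \<Rightarrow> 'n frame_index \<Rightarrow> 'n heis \<Rightarrow> complex) \<Rightarrow> 'n frame_index \<Rightarrow> 'n heis \<Rightarrow> complex"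
  where "codiff_coeff P b = (\<lambda>p. - (\<Sum>a\<in>UNIV. fderiv (bar a) (P a b) p)
    - (if b = Theta then (\<Sum>a\<in>UNIV. \<Sum>e\<in>UNIV. cnj (bracket_coeff a e) * P a e p) / 2 else 0))"

lemma codiff_coeff_test:
  assumes t: "\<And>a b. P a b \<in> test_functions"
  shows "(\<lambda>p. (\<Sum>a\<in>UNIV. \<Sum>e\<in>UNIV. cnj (bracket_coeff a e) * P a e p) / 2) \<in> test_functions"
    and "codiff_coeff P b \<in> test_functions"
proof -
  have "(\<lambda>p. (1/2) * (\<Sum>a\<in>UNIV. \<Sum>e\<in>UNIV. cnj (bracket_coeff a e) * P a e p)) \<in> test_functions"
    by (intro test_cmult test_sum t)
  then show S: "(\<lambda>p. (\<Sum>a\<in>UNIV. \<Sum>e\<in>UNIV. cnj (bracket_coeff a e) * P a e p) / 2) \<in> test_functions"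
    by simp
  show "codiff_coeff P b \<in> test_functions"
    by (cases "b = Theta") (simp_all add: codiff_coeff_def test_uminus test_diff test_sum fderiv_test t S)
qed

text \<open>Pairing with \<open>d \<phi>\<close> gives half a sum over ordered pairs. By
  antisymmetry its two derivative terms agree, and integration by parts yields the divergence; the
  bracket term meets only the \<theta> coefficient of \<phi>.\<close>

lemma codiff2_eq:
  fixes P :: "('n::finite) frame_index \<Rightarrow> 'n frame_index \<Rightarrow> 'n heis \<Rightarrow> complex"
  assumes P: "\<And>a b. coeff2 \<psi> a b = P a b" and t: "\<And>a b. P a b \<in> test_functions"
    and anti: "\<And>a b p. P b a p = - P a b p"
  shows "codiff2 \<psi> = form_of (codiff_coeff P)"
  unfolding codiff2_def
proof (rule formal_adjoint_eqI)
  let ?S = "\<lambda>p. (\<Sum>a\<in>UNIV. \<Sum>e\<in>UNIV. cnj (bracket_coeff a e) * P a e p) / 2"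
  note S = codiff_coeff_test(1)[of P, OF t] and A = codiff_coeff_test(2)[of P, OF t]
  show "form_of (codiff_coeff P) \<in> test_forms1"
    unfolding test_forms1_def using A by blast
  show "pair1 (form_of (codiff_coeff P)) \<phi> = pair2 \<psi> (ext_d1 \<phi>)" if \<phi>_in: "\<phi> \<in> test_forms1" for \<phi>
  proof -
    obtain c where \<phi>: "\<phi> = form_of c" and c: "\<And>a. c a \<in> test_functions"
      using \<phi>_in by (auto simp: test_forms1_def)
    define Q where "Q a b p = fderiv a (c b) p - fderiv b (c a) p - bracket_coeff a b * c Theta p" for a b p
    have Q: "Q a b \<in> test_functions" for a b
      unfolding Q_def by (intro test_diff fderiv_test test_cmult c)
    have neg: "pair0 (P b a) f = - pair0 (P a b) f" for a b f
    proof -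
      have "P b a = (\<lambda>p. - P a b p)" by (rule ext) (rule anti)
      then show ?thesis by (simp only: pair0_uminus_left)
    qed
    have "coeff2 (ext_d1 \<phi>) a b p = Q a b p" for a b p
      unfolding \<phi> Q_def by (rule coeff2_ext_d1[OF c])
    then have "pair2 \<psi> (ext_d1 \<phi>)
        = integral\<^sup>L lebesgue (\<lambda>p. (\<Sum>a\<in>UNIV. \<Sum>b\<in>UNIV. P a b p * cnj (Q a b p)) / 2)"
      by (simp only: pair2_def P)
    also have "\<dots> = (\<Sum>a\<in>UNIV. \<Sum>b\<in>UNIV. pair0 (P a b) (Q a b)) / 2"
      unfolding pair0_def
      by (simp only: integral_divide_zero Bochner_Integration.integral_sum L2_mult_cnj_integrable test_L2 t Q
          Bochner_Integration.integrable_sum)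
    also have "\<dots> = (\<Sum>a\<in>UNIV. \<Sum>b\<in>UNIV. pair0 (P a b) (fderiv a (c b)) - pair0 (P a b) (fderiv b (c a))
        - cnj (bracket_coeff a b) * pair0 (P a b) (c Theta)) / 2"
      unfolding Q_def
      by (simp add: pair0_diff_right pair0_cmult_right test_L2 t c fderiv_test test_cmult test_diff)
    also have "\<dots> = (\<Sum>a\<in>UNIV. \<Sum>b\<in>UNIV. pair0 (P a b) (fderiv a (c b))) / 2
        - (\<Sum>a\<in>UNIV. \<Sum>b\<in>UNIV. pair0 (P a b) (fderiv b (c a))) / 2
        - (\<Sum>a\<in>UNIV. \<Sum>b\<in>UNIV. cnj (bracket_coeff a b) * pair0 (P a b) (c Theta)) / 2"
      by (simp add: sum_subtractf diff_divide_distrib)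
    \<comment> \<open>Exchanging the names of the indices costs a sign, so the two halves add up to
      one full sum.\<close>
    also have "(\<Sum>a\<in>UNIV. \<Sum>b\<in>UNIV. pair0 (P a b) (fderiv b (c a)))
        = - (\<Sum>a\<in>UNIV. \<Sum>b\<in>UNIV. pair0 (P a b) (fderiv a (c b)))"
      by (subst sum.swap, subst neg) (simp add: sum_negf)
    also have "(\<Sum>a\<in>UNIV. \<Sum>b\<in>UNIV. cnj (bracket_coeff a b) * pair0 (P a b) (c Theta)) / 2
        = pair0 ?S (c Theta)"
      by (simp only: divide_inverse mult.commute[of _ "inverse 2"] pair0_cmult_left pair0_sum_left
          test_sum test_cmult t c)
    also have "(\<Sum>a\<in>UNIV. \<Sum>b\<in>UNIV. pair0 (P a b) (fderiv a (c b))) / 2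
        - - (\<Sum>a\<in>UNIV. \<Sum>b\<in>UNIV. pair0 (P a b) (fderiv a (c b))) / 2 - pair0 ?S (c Theta)
        = (\<Sum>b\<in>UNIV. \<Sum>a\<in>UNIV. pair0 (P a b) (fderiv a (c b))) - pair0 ?S (c Theta)"
      by (subst sum.swap) simp
    also have "\<dots> = (\<Sum>b\<in>UNIV. - (\<Sum>a\<in>UNIV. pair0 (fderiv (bar a) (P a b)) (c b))
        - (if b = Theta then pair0 ?S (c b) else 0))"
      by (simp add: pair0_fderiv t c sum_subtractf sum_negf sum.delta)
    also have "\<dots> = (\<Sum>b\<in>UNIV. pair0 (codiff_coeff P b) (c b))"
      by (intro sum.cong refl)
        (simp add: codiff_coeff_def pair0_diff_left pair0_uminus_left pair0_sum_left test_uminus test_sum fderiv_test t S c)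
    also have "\<dots> = pair1 (form_of (codiff_coeff P)) \<phi>"
      unfolding \<phi> by (rule pair1_form_of[symmetric]) (auto intro: test_L2 A c)
    finally show ?thesis by simp
  qed
  show "\<beta> = form_of (codiff_coeff P)" if \<beta>: "\<beta> \<in> test_forms1"
    and eq: "\<And>\<phi>. \<phi> \<in> test_forms1 \<Longrightarrow> pair1 \<beta> \<phi> = pair1 (form_of (codiff_coeff P)) \<phi>" for \<beta>
  proof -
    obtain c where \<beta>: "\<beta> = form_of c" and c: "\<And>a. c a \<in> test_functions"
      using \<beta> by (auto simp: test_forms1_def)
    have "c b = codiff_coeff P b" for b
    proof (rule test_eqI_pair0[OF c A])
      fix h :: "'n heis \<Rightarrow> complex" assume h: "h \<in> test_functions"
      \<comment> \<open>A test form concentrated in the slot \<open>b\<close> isolates the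
        coefficient with that index.\<close>
      let ?h = "\<lambda>a. if a = b then h else (\<lambda>p. 0)"
      have th: "?h a \<in> test_functions" for a by (simp add: h test_zero)
      have *: "pair1 (form_of g) (form_of ?h) = pair0 (g b) h" if g: "\<And>a. g a \<in> test_functions" for g
      proof -
        have "pair1 (form_of g) (form_of ?h) = (\<Sum>a\<in>UNIV. pair0 (g a) (?h a))"
          by (rule pair1_form_of[OF test_L2[OF g] test_L2[OF th]]) (rule coeff1_form_of)
        also have "\<dots> = (\<Sum>a\<in>UNIV. if a = b then pair0 (g b) h else 0)"
          by (intro sum.cong refl) (auto simp: pair0_def)
        finally show ?thesis by (simp add: sum.delta)
      qed
      have "form_of ?h \<in> test_forms1" unfolding test_forms1_def using th by blast
      from eq[OF this] show "pair0 (c b) h = pair0 (codiff_coeff P b) h"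
        unfolding \<beta> by (simp only: *[OF c] *[OF A])
    qed
    then have "c = codiff_coeff P" by (rule ext)
    then show ?thesis unfolding \<beta> by (rule arg_cong)
  qed
qed

section \<open>Comparison of the Laplacians\<close>

text \<open>The scalar Laplacian \<open>\<Delta>\<^sub>0 = d\<^sup>* d\<close> in the unitary frame;
  \<open>dist_Laplace0_eq\<close> links it to the one built from \<open>X\<^sub>j\<close>,
  \<open>Y\<^sub>j\<close> and \<open>T\<close>.\<close>

definition frame_Laplace :: "(('n::finite) heis \<Rightarrow> complex) \<Rightarrow> 'n heis \<Rightarrow> complex" where
  "frame_Laplace f p = - (\<Sum>a\<in>UNIV. fderiv (bar a) (fderiv a f) p)"

lemma frame_Laplace_test: "f \<in> test_functions \<Longrightarrow> frame_Laplace f \<in> test_functions"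
  unfolding frame_Laplace_def by (intro test_uminus test_sum fderiv_test)

lemma sum_frame_index:
  "(\<Sum>a\<in>UNIV. h a) = (\<Sum>j\<in>UNIV. h (Beta j) + h (BetaBar j)) + h (Theta :: ('n::finite) frame_index)"
proof -
  have "(\<Sum>a\<in>range Beta. h a) = (\<Sum>j\<in>UNIV. h (Beta j))"
    and "(\<Sum>a\<in>range BetaBar. h a) = (\<Sum>j\<in>UNIV. h (BetaBar j))"
    by (simp_all add: sum.reindex inj_on_def)
  then show ?thesis
    unfolding UNIV_frame_index
    by (subst sum.union_disjoint, auto)+
      (auto simp: sum.distrib)
qed

text \<open>In the divergence of \<open>d \<phi>\<close>, moving \<open>fderiv b\<close> to the
  front of the mixed second derivatives leaves the Laplacian of \<open>c b\<close>, a commutator and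
  a derivative along \<open>e\<^sub>b\<close>. The bracket term of \<open>d \<phi>\<close> is also a
  derivative along \<open>e\<^sub>b\<close> and joins the latter.\<close>

lemma codiff2_ext_d1_form_of:
  fixes c :: "('n::finite) frame_index \<Rightarrow> 'n heis \<Rightarrow> complex"
  assumes c: "\<And>a. c a \<in> test_functions"
  shows "\<exists>A. codiff2 (ext_d1 (form_of c)) = form_of A \<and> (\<forall>b. A b \<in> test_functions) \<and>
    (\<forall>b p. b \<noteq> Theta \<longrightarrow> A b p =
      frame_Laplace (c b) p + bar_bracket b * fderiv Theta (c b) p
      + fderiv b (\<lambda>p. (\<Sum>a\<in>UNIV. fderiv (bar a) (c a) p) + bar_bracket b * c Theta p) p)"
proof -
  define P where "P a b p = fderiv a (c b) p - fderiv b (c a) p - bracket_coeff a b * c Theta p" for a b p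
  have P: "P a b \<in> test_functions" for a b
    unfolding P_def by (intro test_diff fderiv_test test_cmult c)
  have coeff: "coeff2 (ext_d1 (form_of c)) a b = P a b" for a b
    by (rule ext) (simp add: P_def coeff2_ext_d1[OF c])
  have bracket: "bracket_coeff b a = - bracket_coeff a b" for a b :: "'n frame_index"
    by (cases a; cases b) (auto simp: bracket_coeff_def)
  have anti: "P b a p = - P a b p" for a b p
    by (simp add: P_def bracket[of b a])
  \<comment> \<open>The commutator survives only for \<open>a = b\<close>. The bracket term of
    \<open>d \<phi>\<close> survives only for \<open>a = bar b\<close>, where
    \<open>fderiv (bar a)\<close> is \<open>fderiv b\<close>.\<close>
  have "fderiv (bar a) (P a b) p = fderiv (bar a) (fderiv a (c b)) p
      - fderiv b (fderiv (bar a) (c a)) p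
      - fderiv Theta (c a) p * (if a = b then bar_bracket b else 0)
      - fderiv (bar a) (c Theta) p * (if a = bar b then bar_bracket b else 0)" for a b p
  proof -
    have "fderiv (bar a) (P a b) p = fderiv (bar a) (fderiv a (c b)) p
      - fderiv (bar a) (fderiv b (c a)) p - bracket_coeff a b * fderiv (bar a) (c Theta) p"
      unfolding P_def by (simp add: fderiv_diff fderiv_cmult test_diff fderiv_test test_cmult c)
    moreover have "bar a = bar b \<longleftrightarrow> a = b"
      by (metis bar_bar)
    ultimately show ?thesis
      by (simp add: fderiv_commutator[OF c, of "bar a" b] bracket_coeff_def algebra_simps)
  qed
  then have sum: "(\<Sum>a\<in>UNIV. fderiv (bar a) (P a b) p) = (\<Sum>a\<in>UNIV. fderiv (bar a) (fderiv a (c b)) p)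
      - (\<Sum>a\<in>UNIV. fderiv b (fderiv (bar a) (c a)) p)
      - fderiv Theta (c b) p * bar_bracket b - fderiv b (c Theta) p * bar_bracket b" for b p
    by (simp add: sum_subtractf sum_mult_delta[where g="\<lambda>_. bar_bracket b"])
  show ?thesis
  proof (intro exI[of _ "codiff_coeff P"] conjI allI impI)
    show "codiff2 (ext_d1 (form_of c)) = form_of (codiff_coeff P)"
      by (rule codiff2_eq[OF coeff P anti])
    show "codiff_coeff P b \<in> test_functions" for b
      by (rule codiff_coeff_test(2)[of P, OF P])
    fix b :: "'n frame_index" and p assume "b \<noteq> Theta"
    then show "codiff_coeff P b p
      = frame_Laplace (c b) p + bar_bracket b * fderiv Theta (c b) p
        + fderiv b (\<lambda>p. (\<Sum>a\<in>UNIV. fderiv (bar a) (c a) p) + bar_bracket b * c Theta p) p"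
      by (simp add: codiff_coeff_def sum frame_Laplace_def fderiv_add fderiv_cmult fderiv_sum
          test_sum test_cmult fderiv_test c)
  qed
qed

section \<open>The scalar Laplacian in the real and in the unitary frame\<close>

lemma
  fixes f :: "('n::finite) heis \<Rightarrow> complex"
  assumes f: "f \<in> test_functions"
  shows vf_X: "vf_apply (X_field j) f
      = (\<lambda>p. complex_of_real (1 / sqrt 2) * (fderiv (Beta j) f p + fderiv (BetaBar j) f p))"
    and vf_Y: "vf_apply (Y_field j) f
      = (\<lambda>p. \<i> * complex_of_real (1 / sqrt 2) * (fderiv (Beta j) f p - fderiv (BetaBar j) f p))"
    and vf_T: "vf_apply T_field f = fderiv Theta f"
proof -
  have lin: "linear (frechet_derivative f (at p))" for p
    by (rule linear_frechet_derivative[OF test_differentiable[OF f]])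
  \<comment> \<open>Naming the normalizing factor lets the algebra run on
    \<open>r * r = 1 / 2\<close> alone, without simplifying square roots.\<close>
  define r where "r = complex_of_real (1 / sqrt 2)"
  have r: "r * r = 1 / 2"
    unfolding r_def of_real_mult[symmetric] by simp
  have B: "fderiv (Beta j) f p = r * (pd (X_field j p) f p - \<i> * pd (Y_field j p) f p)"
    and BB: "fderiv (BetaBar j) f p = r * (pd (X_field j p) f p + \<i> * pd (Y_field j p) f p)" for p
    by (simp_all add: fderiv_def ceval_def linear_neg[OF lin] linear_scale[OF lin] r_def
        scaleR_conv_of_real algebra_simps)
  have "r * (fderiv (Beta j) f p + fderiv (BetaBar j) f p) = 2 * (r * r) * pd (X_field j p) f p" for p
    unfolding B BB by (simp add: algebra_simps)
  then show "vf_apply (X_field j) f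
      = (\<lambda>p. complex_of_real (1 / sqrt 2) * (fderiv (Beta j) f p + fderiv (BetaBar j) f p))"
    unfolding r_def[symmetric] by (simp add: vf_apply_def r)
  have "\<i> * r * (fderiv (Beta j) f p - fderiv (BetaBar j) f p) = 2 * (r * r) * pd (Y_field j p) f p" for p
    unfolding B BB by (simp add: algebra_simps)
  then show "vf_apply (Y_field j) f
      = (\<lambda>p. \<i> * complex_of_real (1 / sqrt 2) * (fderiv (Beta j) f p - fderiv (BetaBar j) f p))"
    unfolding r_def[symmetric] by (simp add: vf_apply_def r)
  show "vf_apply T_field f = fderiv Theta f"
    by (simp add: fun_eq_iff vf_apply_def fderiv_def ceval_def linear_0[OF lin])
qed

lemma vf_test:
  assumes "f \<in> test_functions"
  shows "vf_apply (X_field j) f \<in> test_functions" "vf_apply (Y_field j) f \<in> test_functions"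
    "vf_apply T_field f \<in> test_functions"
  unfolding vf_X[OF assms] vf_Y[OF assms] vf_T[OF assms]
  by (intro test_cmult test_add test_diff fderiv_test assms)+

text \<open>The pure squares of the two complex fields cancel between the two terms; the mixed
  products survive, once in each order.\<close>

lemma vf_XX_YY:
  assumes f: "f \<in> test_functions"
  shows "vf_apply (X_field j) (vf_apply (X_field j) f) p + vf_apply (Y_field j) (vf_apply (Y_field j) f) p
    = fderiv (BetaBar j) (fderiv (Beta j) f) p + fderiv (Beta j) (fderiv (BetaBar j) f) p"
proof -
  define r where "r = complex_of_real (1 / sqrt 2)"
  have r: "r * r = 1 / 2"
    unfolding r_def of_real_mult[symmetric] by simp
  let ?D = "fderiv (Beta j)" and ?E = "fderiv (BetaBar j)"
  have X: "vf_apply (X_field j) (vf_apply (X_field j) f) p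
      = (r * r) * (?D (?D f) p + ?D (?E f) p + ?E (?D f) p + ?E (?E f) p)"
    unfolding vf_X[OF vf_test(1)[OF f]] unfolding vf_X[OF f] r_def[symmetric]
    by (simp add: fderiv_cmult fderiv_add test_add fderiv_test f) (simp add: algebra_simps)
  have Y: "vf_apply (Y_field j) (vf_apply (Y_field j) f) p
      = - (r * r) * (?D (?D f) p - ?D (?E f) p - ?E (?D f) p + ?E (?E f) p)"
    unfolding vf_Y[OF vf_test(2)[OF f]] unfolding vf_Y[OF f] r_def[symmetric]
    by (simp add: fderiv_cmult fderiv_diff test_diff fderiv_test f) (simp add: algebra_simps)
  show ?thesis
    unfolding X Y r by (simp add: field_simps)
qed

text \<open>Each field is applied twice, so the signs from transposition cancel. Agreement of
  \<open>u\<close> with the pairing is asked on test functions only, where distributions are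
  meaningful.\<close>

lemma dist_Laplace0_eq:
  assumes u: "\<And>f. f \<in> test_functions \<Longrightarrow> u f = pair0 w f"
    and w: "w \<in> L2_functions" and f: "f \<in> test_functions"
  shows "dist_Laplace0 u f = pair0 w (frame_Laplace f)"
proof -
  have "dist_Laplace0 u f = - (\<Sum>j\<in>UNIV. pair0 w (vf_apply (X_field j) (vf_apply (X_field j) f))
      + pair0 w (vf_apply (Y_field j) (vf_apply (Y_field j) f)))
      - pair0 w (vf_apply T_field (vf_apply T_field f))"
    by (simp add: dist_Laplace0_def dist_vf_def u vf_test f)
  moreover have "pair0 w (vf_apply (X_field j) (vf_apply (X_field j) f))
      + pair0 w (vf_apply (Y_field j) (vf_apply (Y_field j) f))
      = pair0 w (fderiv (BetaBar j) (fderiv (Beta j) f)) + pair0 w (fderiv (Beta j) (fderiv (BetaBar j) f))" for j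
    by (simp only: pair0_add_right[OF w, symmetric] vf_test f fderiv_test vf_XX_YY)
  ultimately have "dist_Laplace0 u f = - (\<Sum>a\<in>UNIV. pair0 w (fderiv (bar a) (fderiv a f)))"
    by (simp add: sum_frame_index vf_T f fderiv_test)
  also have "\<dots> = pair0 w (frame_Laplace f)"
    unfolding frame_Laplace_def
    by (simp add: pair0_uminus_right pair0_sum_right w f fderiv_test)
  finally show ?thesis .
qed

lemma dist_coeff_form_of:
  assumes w: "\<And>a. w a \<in> L2_functions" and f: "f \<in> test_functions"
  shows "dist_coeff (dist_of_form1 (form_of w)) a f = pair0 (w a) f"
proof -
  have "coeff1 (\<lambda>p v. f p * coframe a p v) b = (if b = a then f else (\<lambda>p. 0))" for b
    by (rule ext) (simp add: coeff1_def ceval_cmult ceval_coframe)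
  then have "pair1 (form_of w) (\<lambda>p v. f p * coframe a p v)
      = (\<Sum>b\<in>UNIV. pair0 (w b) (if b = a then f else (\<lambda>p. 0)))"
    by (intro pair1_form_of w) (simp_all add: test_L2 f test_zero)
  also have "\<dots> = (\<Sum>b\<in>UNIV. if b = a then pair0 (w a) f else 0)"
    by (intro sum.cong refl) (auto simp: pair0_def)
  finally show ?thesis
    by (simp add: dist_coeff_def dist_of_form1_def sum.delta)
qed

text \<open>Treats both types at once, with \<open>s\<close> the common value of the bracket
  constants on the nonzero components. As \<open>s\<close> is imaginary, conjugating it in the
  second argument of the pairing gives the sign with which \<open>T\<close> acts on
  distributions.\<close>

lemma Laplace1_pure_type:
  fixes w :: "('n::finite) frame_index \<Rightarrow> 'n heis \<Rightarrow> complex"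
  assumes w: "\<And>a. w a \<in> L2_functions"
    and pure: "\<And>b. w b \<noteq> (\<lambda>p. 0) \<Longrightarrow> b \<noteq> Theta \<and> bar_bracket b = s"
    and s: "cnj s = - s"
    and closed: "co_closed (form_of w)"
  shows "dist1_eq (dist_Laplace1 (dist_of_form1 (form_of w)))
    (componentwise (\<lambda>u f. dist_Laplace0 u f + s * dist_vf T_field u f) (dist_of_form1 (form_of w)))"
  unfolding dist1_eq_def
proof
  fix \<phi> :: "'n form1"
  assume "\<phi> \<in> test_forms1"
  then obtain c where \<phi>: "\<phi> = form_of c" and c: "\<And>a. c a \<in> test_functions"
    unfolding test_forms1_def by blast
  \<comment> \<open>Having \<open>s\<close> in place of \<open>bar_bracket b\<close> makes
    \<open>F\<close> independent of \<open>b\<close>, so that the terms \<open>fderiv b F\<close>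
    are the coefficients of the single form \<open>d F\<close>.\<close>
  define F where "F p = (\<Sum>a\<in>UNIV. fderiv (bar a) (c a) p) + s * c Theta p" for p
  have F: "F \<in> test_functions"
    unfolding F_def by (intro test_add test_sum fderiv_test test_cmult c)
  \<comment> \<open>Used twice: for \<open>codiff1 \<phi>\<close>, which removes the term
    \<open>d d\<^sup>*\<close>, and for \<open>F\<close>.\<close>
  have closed0: "pair1 (form_of w) (ext_d0 f) = 0" if "f \<in> test_functions" for f
    using closed that by (simp add: co_closed_def dist_codiff1_def dist_of_form1_def)
  have "codiff1 \<phi> \<in> test_functions"
    unfolding \<phi> codiff1_form_of[OF c] by (intro test_uminus test_sum fderiv_test c)
  moreover obtain A where A: "codiff2 (ext_d1 (form_of c)) = form_of A" and A_test: "\<And>b. A b \<in> test_functions"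
    and A_eq: "\<And>b p. b \<noteq> Theta \<Longrightarrow> A b p =
      frame_Laplace (c b) p + bar_bracket b * fderiv Theta (c b) p
      + fderiv b (\<lambda>p. (\<Sum>a\<in>UNIV. fderiv (bar a) (c a) p) + bar_bracket b * c Theta p) p"
    using codiff2_ext_d1_form_of[of c, OF c] by blast
  ultimately have "dist_Laplace1 (dist_of_form1 (form_of w)) \<phi> = pair1 (form_of w) (form_of A)"
    using closed0 by (simp add: A[folded \<phi>] dist_Laplace1_def dist_ext_d0_def dist_codiff1_def dist_codiff2_def
        dist_ext_d1_def dist_of_form1_def)
  also have "\<dots> = (\<Sum>b\<in>UNIV. pair0 (w b) (A b))"
    by (rule pair1_form_of[OF w test_L2[OF A_test]]) (rule coeff1_form_of)
  also have "\<dots> = (\<Sum>b\<in>UNIV. pair0 (w b) (frame_Laplace (c b)) - s * pair0 (w b) (fderiv Theta (c b))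
      + pair0 (w b) (fderiv b F))"
  proof (intro sum.cong refl)
    fix b
    show "pair0 (w b) (A b) = pair0 (w b) (frame_Laplace (c b)) - s * pair0 (w b) (fderiv Theta (c b))
      + pair0 (w b) (fderiv b F)"
    proof (cases "w b = (\<lambda>p. 0)")
      case True
      then show ?thesis by (simp add: pair0_def)
    next
      case False
      then have b: "b \<noteq> Theta" "bar_bracket b = s" using pure by auto
      have "A b = (\<lambda>p. frame_Laplace (c b) p + s * fderiv Theta (c b) p + fderiv b F p)"
        by (rule ext) (simp add: A_eq[OF b(1)] b(2) F_def[abs_def])
      then show ?thesis
        by (simp add: pair0_add_right pair0_cmult_right w frame_Laplace_test fderiv_test test_add
            test_cmult c F s)
    qed
  qed
  \<comment> \<open>Vanishing components of \<open>w\<close> contribute zero, so the sum over all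
    \<open>b\<close> is the full pairing with \<open>d F\<close>.\<close>
  also have "\<dots> = (\<Sum>b\<in>UNIV. pair0 (w b) (frame_Laplace (c b)) - s * pair0 (w b) (fderiv Theta (c b)))
      + pair1 (form_of w) (ext_d0 F)"
    by (simp add: sum.distrib pair1_form_of[OF w test_L2[OF fderiv_test[OF F]] coeff1_ext_d0])
  also have "\<dots> = (\<Sum>b\<in>UNIV. pair0 (w b) (frame_Laplace (c b)) - s * pair0 (w b) (fderiv Theta (c b)))"
    by (simp add: closed0 F)
  also have "\<dots> = componentwise (\<lambda>u f. dist_Laplace0 u f + s * dist_vf T_field u f)
      (dist_of_form1 (form_of w)) \<phi>"
    unfolding componentwise_def \<phi> coeff1_form_of
    by (intro sum.cong refl)
      (simp add: dist_Laplace0_eq[OF dist_coeff_form_of[of w, OF w] w c] dist_vf_def vf_T c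
        dist_coeff_form_of[OF w] fderiv_test)
  finally show "dist_Laplace1 (dist_of_form1 (form_of w)) \<phi>
    = componentwise (\<lambda>u f. dist_Laplace0 u f + s * dist_vf T_field u f) (dist_of_form1 (form_of w)) \<phi>" .
qed

text \<open>Square integrability and pure type come with separate coefficient families. Duality of
  frame and coframe identifies them at every point, so the square-integrable family vanishes
  identically off the given type.\<close>

lemma pure_type_coefficients:
  assumes "\<omega> \<in> L2_forms1" and \<omega>: "\<omega> = (\<lambda>p v. \<Sum>j\<in>UNIV. f j p * coframe (\<tau> j) p v)"
  shows "\<exists>w. \<omega> = form_of w \<and> (\<forall>a. w a \<in> L2_functions) \<and> (\<forall>b. b \<notin> range \<tau> \<longrightarrow> w b = (\<lambda>p. 0))"
proof -
  obtain w where w: "\<omega> = form_of w" "\<And>a. w a \<in> L2_functions"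
    using assms(1) unfolding L2_forms1_def by blast
  have "w b = (\<lambda>p. 0)" if "b \<notin> range \<tau>" for b
  proof
    fix p
    have "w b p = coeff1 \<omega> b p" by (simp add: w(1))
    also have "\<dots> = (\<Sum>j\<in>UNIV. f j p * (if \<tau> j = b then 1 else 0))"
      by (simp add: \<omega> coeff1_def ceval_sum ceval_cmult ceval_coframe)
    also have "\<dots> = 0"
      using that by (intro sum.neutral) auto
    finally show "w b p = 0" .
  qed
  then show ?thesis using w by blast
qed

theorem proposition4p6:
  fixes \<omega> :: "('n::finite) form1"
  shows "(\<omega> \<in> V2_plus \<longrightarrow>
            dist1_eq (dist_Laplace1 (dist_of_form1 \<omega>))
              (componentwise (\<lambda>u f. dist_Laplace0 u f - \<i> * dist_vf T_field u f) (dist_of_form1 \<omega>))) \<and>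
         (\<omega> \<in> V2_minus \<longrightarrow>
            dist1_eq (dist_Laplace1 (dist_of_form1 \<omega>))
              (componentwise (\<lambda>u f. dist_Laplace0 u f + \<i> * dist_vf T_field u f) (dist_of_form1 \<omega>)))"
proof (intro conjI impI)
  assume "\<omega> \<in> V2_plus"
  then obtain f where L2: "\<omega> \<in> L2_forms1" and closed: "co_closed \<omega>"
    and f: "\<omega> = (\<lambda>p v. \<Sum>j\<in>UNIV. f j p * coframe (Beta j) p v)"
    unfolding V2_plus_def forms_1_0_def by blast
  obtain w where w: "\<omega> = form_of w" "\<And>a. w a \<in> L2_functions"
    "\<And>b. w b \<noteq> (\<lambda>p. 0) \<Longrightarrow> b \<in> range Beta"
    using pure_type_coefficients[OF L2 f] by blast
  have "b \<noteq> Theta \<and> bar_bracket b = - \<i>" if "w b \<noteq> (\<lambda>p. 0)" for b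
    using w(3)[OF that] by auto
  \<comment> \<open>On \<open>(1,0)\<close>-forms the common bracket constant is
    \<open>- \<i>\<close>, which is the coefficient of \<open>T\<close> in the claim.\<close>
  from Laplace1_pure_type[of w "- \<i>", OF w(2) this]
  show "dist1_eq (dist_Laplace1 (dist_of_form1 \<omega>))
      (componentwise (\<lambda>u f. dist_Laplace0 u f - \<i> * dist_vf T_field u f) (dist_of_form1 \<omega>))"
    using closed by (simp add: w(1))
next
  assume "\<omega> \<in> V2_minus"
  then obtain f where L2: "\<omega> \<in> L2_forms1" and closed: "co_closed \<omega>"
    and f: "\<omega> = (\<lambda>p v. \<Sum>j\<in>UNIV. f j p * coframe (BetaBar j) p v)"
    unfolding V2_minus_def forms_0_1_def by blast
  obtain w where w: "\<omega> = form_of w" "\<And>a. w a \<in> L2_functions"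
    "\<And>b. w b \<noteq> (\<lambda>p. 0) \<Longrightarrow> b \<in> range BetaBar"
    using pure_type_coefficients[OF L2 f] by blast
  have "b \<noteq> Theta \<and> bar_bracket b = \<i>" if "w b \<noteq> (\<lambda>p. 0)" for b
    using w(3)[OF that] by auto
  from Laplace1_pure_type[of w "\<i>", OF w(2) this]
  show "dist1_eq (dist_Laplace1 (dist_of_form1 \<omega>))
      (componentwise (\<lambda>u f. dist_Laplace0 u f + \<i> * dist_vf T_field u f) (dist_of_form1 \<omega>))"
    using closed by (simp add: w(1))
qed

end
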